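(* Let $0<\alpha<\beta<1$, let $\mathcal I$ be a non-empty finite index set with $m=\#\mathcal I$, and for $i\in\mathcal I$ let $T_i(x,y)=(\beta x,\alpha y)+(b_i,a_i)$ where $0\le b_i\le 1-\beta$ and $0\le a_i\le 1-\alpha$. Let $K\subset\mathbb{R}^2$ be the attractor of $(T_i)_{i\in\mathcal I}$, and assume that $T_i((0,1)^2)\cap T_j((0,1)^2)=\varnothing$ for all $i\ne j$. Let $\pi(x,y)=x$, let $\nu$ be the uniform self-similar measure associated with the projected IFS $(x\mapsto\beta x+b_i)_{i\in\mathcal I}$, and let $s=\dim_\infty\nu$ be the Frostman dimension of $\nu$. Then $$\dim_{\mathrm A}K=\dim_{\mathrm A}\pi(K)+\frac{\log(m\beta^s)}{\log(1/\alpha)}.$$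
   Context: The attractor $K$ is the unique non-empty compact set with $K=\bigcup_{i\in\mathcal I}T_i(K)$. The measure $\nu$ is the unique Borel probability measure on $\mathbb{R}$ with $\nu=\sum_{i\in\mathcal I}\frac1m\,\nu\circ S_i^{-1}$, where $S_i(x)=\beta x+b_i$ (the maps $S_i$ need not be distinct); equivalently, $\nu=\mu\circ\pi^{-1}$ where $\mu$ is the self-affine measure on $K$ giving equal weights $1/m$ to the maps $T_i$. The Frostman dimension is $\dim_\infty\nu=\sup\{t\ge0:\exists C>0\ \forall r\in(0,1)\ \forall z\in\mathbb{R},\ \nu(B(z,r))\le Cr^t\}$. The Assouad dimension of a bounded set $F\subset\mathbb{R}^d$ is $$\dim_{\mathrm A}F=\inf\Bigl\{s\ge 0:\exists C>0\ \forall\,0<r\le R\le 1\ \forall x\in F,\ N_r(F\cap B(x,R))\le C\bigl(\tfrac{R}{r}\bigr)^s\Bigr\},$$ where $N_r(E)$ is the smallest number of open balls of radius $r$ needed to cover $E$. *)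

theory Defs
  imports "HOL-Probability.Probability"
begin

definition is_attractor :: "'i set \<Rightarrow> ('i \<Rightarrow> 'a::metric_space \<Rightarrow> 'a) \<Rightarrow> 'a set \<Rightarrow> bool" where
  "is_attractor I T K \<longleftrightarrow> compact K \<and> K \<noteq> {} \<and> K = (\<Union>i\<in>I. T i ` K)"

text \<open>Invariance is summed over indices, so maps that coincide are counted with multiplicity.\<close>

definition is_uniform_self_similar_measure ::
    "'i set \<Rightarrow> ('i \<Rightarrow> real \<Rightarrow> real) \<Rightarrow> real measure \<Rightarrow> bool" where
  "is_uniform_self_similar_measure I S \<nu> \<longleftrightarrow>
     prob_space \<nu> \<and> sets \<nu> = sets borel \<and>
     (\<forall>A\<in>sets borel. measure \<nu> A = (\<Sum>i\<in>I. 1 / real (card I) * measure \<nu> (S i -` A)))"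

text \<open>For a probability measure on the line the set below contains 0 and is bounded above
  by 1, so the real supremum is the genuine one.\<close>

definition frostman_dim :: "real measure \<Rightarrow> real" where
  "frostman_dim \<nu> =
     Sup {t. 0 \<le> t \<and> (\<exists>C>0. \<forall>r\<in>{0<..<1}. \<forall>z. measure \<nu> (ball z r) \<le> C * r powr t)}"

text \<open>Centres range over the ambient space. The minimum exists whenever \<open>E\<close> is bounded
  and \<open>r > 0\<close>.\<close>

definition covering_number :: "real \<Rightarrow> 'a::euclidean_space set \<Rightarrow> nat" where
  "covering_number r E = (LEAST n. \<exists>X. finite X \<and> card X = n \<and> E \<subseteq> (\<Union>x\<in>X. ball x r))"

text \<open>Meaningful for bounded \<open>F\<close>; the set of exponents then contains the dimension of
  the ambient space, so the real infimum is the genuine one.\<close>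

definition assouad_dim :: "'a::euclidean_space set \<Rightarrow> real" where
  "assouad_dim F =
     Inf {s. 0 \<le> s \<and> (\<exists>C>0. \<forall>r R. 0 < r \<and> r \<le> R \<and> R \<le> 1 \<longrightarrow>
       (\<forall>x\<in>F. real (covering_number r (F \<inter> ball x R)) \<le> C * (R / r) powr s))}"

end

theory Submission imports Defs begin

text \<open>
  Write \<open>X = fst ` K\<close>, \<open>T\<^sub>u\<close> for the composition of maps along a word \<open>u\<close>, and
  \<open>\<kappa> t = ln (m \<beta>\<^sup>t) / ln (1 / \<alpha>)\<close>, so that \<open>(1 / \<alpha>) powr \<kappa> t = m \<beta>\<^sup>t\<close>.
  A cylinder of level \<open>n\<close> is a box of width \<open>\<beta>\<^sup>n\<close> and much smaller height \<open>\<alpha>\<^sup>n\<close>. A square of side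
  \<open>\<alpha>\<^sup>n\<close> meets boundedly many of them (lemma \<open>words_meeting_ball_le\<close>), and inside one of them it
  looks, after rescaling, like a thin vertical strip over an interval \<open>J\<close> of length \<open>(\<alpha> / \<beta>)\<^sup>n\<close>.
  The part of \<open>K\<close> over \<open>J\<close> is seen at relative resolution \<open>\<alpha>\<^sup>l\<close> as a stack of cylinders of
  words of length \<open>l\<close>. The number of floors in the stack is \<open>m\<^sup>l\<close> times the \<open>\<nu>\<close>-mass near \<open>J\<close>, hence
  at most about \<open>(m \<beta>\<^sup>s)\<^sup>l\<close>, and each floor is a flat copy of a piece of \<open>X\<close>. The relative
  resolution being \<open>\<alpha>\<^sup>l\<close>, the stack contributes \<open>\<kappa> s\<close> to the exponent and the floors contribute
  the Assouad dimension of \<open>X\<close>.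

  Upper bound (lemma \<open>assouad_exponent_K\<close>): if \<open>t\<close> is a Frostman exponent of \<open>\<nu>\<close> and \<open>e\<close> an Assouad
  exponent of \<open>X\<close>, multiplying the two counts shows that \<open>e + \<kappa> t\<close> is an Assouad exponent of \<open>K\<close>.

  Lower bound (lemma \<open>assouad_exponent_fst_K\<close>): all floors of one stack must be rich over the same
  tiny interval, although a spot where \<open>X\<close> is rich sits at a different place in different
  floors. Fix a rich spot, the ball of radius \<open>\<rho>\<close> about \<open>x \<in> X\<close>, and let \<open>peak n\<close> be the largest number
  of words of length \<open>n\<close> whose images of \<open>x\<close> lie within \<open>\<beta>\<^sup>n \<rho>\<close> of a common point. If \<open>t \<ge> 0\<close> is not a
  Frostman exponent, \<open>peak\<close> is not bounded by a multiple of \<open>(m \<beta>\<^sup>t)\<^sup>n\<close>. The factor lost because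
  \<open>\<rho>\<close> may be very small is the same for all \<open>n\<close>, so it disappears in the ratios of \<open>peak\<close>, and
  \<open>peak (l + G) \<ge> (m \<beta>\<^sup>t)\<^sup>l peak G\<close> for arbitrarily large \<open>G\<close>. A fixed prefix of length
  \<open>l\<close> accounts for at most \<open>peak G\<close> of these words, so at least \<open>(m \<beta>\<^sup>t)\<^sup>l\<close> prefixes
  carry a copy of the rich spot at the same place (lemma \<open>many_prefixes\<close>); these are the floors of
  a stack in which every floor is rich. Hence an Assouad exponent \<open>A\<close> of \<open>K\<close> makes \<open>A - \<kappa> t\<close> an Assouad
  exponent of \<open>X\<close>. Letting \<open>t\<close> tend to \<open>s\<close> from either side gives the formula.
\<close>

section \<open>Covering numbers\<close>

lemma covering_number_le:
  assumes "finite X" "E \<subseteq> (\<Union>x\<in>X. ball x r)"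
  shows "covering_number r E \<le> card X"
  unfolding covering_number_def by (rule Least_le) (use assms in blast)

lemma covering_number_witness:
  fixes E :: "'a::euclidean_space set"
  assumes "bounded E" "0 < r"
  obtains X where "finite X" "card X = covering_number r E" "E \<subseteq> (\<Union>x\<in>X. ball x r)"
proof -
  have "compact (closure E)"
    using assms(1) by (simp add: compact_closure)
  then obtain k where k: "finite k" "closure E \<subseteq> (\<Union>x\<in>k. ball x r)"
    using assms(2) by (auto simp: compact_eq_totally_bounded)
  then have "\<exists>n X. finite X \<and> card X = n \<and> E \<subseteq> (\<Union>x\<in>X. ball x r)"
    using closure_subset by blast
  then have "\<exists>X. finite X \<and> card X = covering_number r E \<and> E \<subseteq> (\<Union>x\<in>X. ball x r)"
    unfolding covering_number_def by (rule LeastI_ex)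
  then show thesis using that by blast
qed

lemma covering_number_mono:
  fixes F :: "'a::euclidean_space set"
  assumes "E \<subseteq> F" "bounded F" "0 < r"
  shows "covering_number r E \<le> covering_number r F"
proof -
  obtain X where "finite X" "card X = covering_number r F" "F \<subseteq> (\<Union>x\<in>X. ball x r)"
    using covering_number_witness[OF assms(2,3)] by blast
  then show ?thesis using covering_number_le[of X E r] assms(1) by simp
qed

lemma covering_number_antimono_radius:
  fixes E :: "'a::euclidean_space set"
  assumes "bounded E" "0 < r" "r \<le> r'"
  shows "covering_number r' E \<le> covering_number r E"
proof -
  obtain X where X: "finite X" "card X = covering_number r E" "E \<subseteq> (\<Union>x\<in>X. ball x r)"
    using covering_number_witness[OF assms(1,2)] by blast
  have "(\<Union>x\<in>X. ball x r) \<subseteq> (\<Union>x\<in>X. ball x r')" using assms(3) by (force simp: subset_eq)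
  then have "E \<subseteq> (\<Union>x\<in>X. ball x r')" using X(3) by blast
  then show ?thesis using covering_number_le[of X E r'] X by simp
qed

lemma covering_number_empty [simp]: "covering_number r {} = 0"
  using covering_number_le[of "{}" "{}" r] by simp

lemma covering_number_ge_1:
  fixes E :: "'a::euclidean_space set"
  assumes "bounded E" "0 < r" "E \<noteq> {}"
  shows "1 \<le> covering_number r E"
proof -
  obtain X where X: "finite X" "card X = covering_number r E" "E \<subseteq> (\<Union>x\<in>X. ball x r)"
    using covering_number_witness[OF assms(1,2)] by blast
  then have "X \<noteq> {}" using assms(3) by auto
  then show ?thesis using X(1,2) by (metis Suc_leI One_nat_def card_gt_0_iff)
qed

lemma covering_number_UN_le:
  fixes E :: "'b \<Rightarrow> 'a::euclidean_space set"
  assumes "finite J" "\<And>j. j \<in> J \<Longrightarrow> bounded (E j)" "0 < r"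
  shows "covering_number r (\<Union>j\<in>J. E j) \<le> (\<Sum>j\<in>J. covering_number r (E j))"
proof -
  have "\<forall>j\<in>J. \<exists>X. finite X \<and> card X = covering_number r (E j) \<and> E j \<subseteq> (\<Union>x\<in>X. ball x r)"
    using covering_number_witness[OF assms(2) assms(3)] by metis
  then obtain X where X: "\<And>j. j \<in> J \<Longrightarrow> finite (X j)"
    "\<And>j. j \<in> J \<Longrightarrow> card (X j) = covering_number r (E j)"
    "\<And>j. j \<in> J \<Longrightarrow> E j \<subseteq> (\<Union>x\<in>X j. ball x r)" by metis
  have "finite (\<Union>j\<in>J. X j)" using X(1) assms(1) by blast
  moreover have "(\<Union>j\<in>J. E j) \<subseteq> (\<Union>x\<in>(\<Union>j\<in>J. X j). ball x r)" using X(3) by (simp add: SUP_le_iff UN_least subset_iff) blast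
  ultimately have "covering_number r (\<Union>j\<in>J. E j) \<le> card (\<Union>j\<in>J. X j)"
    by (rule covering_number_le)
  also have "\<dots> \<le> (\<Sum>j\<in>J. card (X j))" by (rule card_UN_le[OF assms(1)])
  finally show ?thesis using X(2) by simp
qed

lemma covering_number_affine_image:
  fixes E :: "real set"
  assumes "bounded E" "0 < r" "0 < g"
  shows "covering_number (g * r) ((\<lambda>x. g * x + c) ` E) = covering_number r E"
proof -
  have le: "covering_number (h * p) ((\<lambda>x. h * x + d) ` F) \<le> covering_number p F"
    if F: "bounded F" and p: "0 < p" and h: "0 < h" for F :: "real set" and p h d :: real
  proof -
    obtain X where X: "finite X" "card X = covering_number p F" "F \<subseteq> (\<Union>x\<in>X. ball x p)"
      using covering_number_witness[OF F p] by blast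
    have "(\<lambda>x. h * x + d) ` F \<subseteq> (\<Union>x\<in>(\<lambda>x. h * x + d) ` X. ball x (h * p))"
    proof clarify
      fix y assume "y \<in> F"
      then obtain x where x: "x \<in> X" "\<bar>x - y\<bar> < p" using X(3) by (auto simp: dist_real_def)
      have "\<bar>(h * x + d) - (h * y + d)\<bar> = h * \<bar>x - y\<bar>"
        using h by (simp flip: abs_mult_pos' right_diff_distrib)
      also have "\<dots> < h * p" using x h by simp
      finally show "h * y + d \<in> (\<Union>x\<in>(\<lambda>x. h * x + d) ` X. ball x (h * p))"
        using x(1) by (auto simp: dist_real_def)
    qed
    then have "covering_number (h * p) ((\<lambda>x. h * x + d) ` F) \<le> card ((\<lambda>x. h * x + d) ` X)"
      using X(1) by (intro covering_number_le) auto
    also have "\<dots> \<le> card X" using X(1) by (rule card_image_le)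
    finally show ?thesis using X(2) by simp
  qed
  have b: "bounded ((\<lambda>x. g * x + c) ` E)"
    using bounded_translation[OF bounded_scaling[OF assms(1), of g], of c]
    by (simp add: image_image add.commute)
  have inv: "(\<lambda>x. (1 / g) * x + (- c / g)) ` (\<lambda>x. g * x + c) ` E = E"
    using assms(3) by (simp add: image_image field_simps)
  have "covering_number ((1 / g) * (g * r)) E \<le> covering_number (g * r) ((\<lambda>x. g * x + c) ` E)"
    using le[OF b, of "g * r" "1 / g" "- c / g"] assms inv by simp
  then show ?thesis using le[OF assms, of c] assms by simp
qed

lemma covering_number_fst_le:
  fixes E :: "(real \<times> real) set"
  assumes "bounded E" "0 < r"
  shows "covering_number r (fst ` E) \<le> covering_number r E"
proof -
  obtain X where X: "finite X" "card X = covering_number r E" "E \<subseteq> (\<Union>x\<in>X. ball x r)"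
    using covering_number_witness[OF assms] by blast
  have "fst ` E \<subseteq> (\<Union>x\<in>fst ` X. ball x r)"
  proof clarify
    fix x y assume "(x, y) \<in> E"
    then obtain p where p: "p \<in> X" "dist p (x, y) < r" using X(3) by auto
    then have "dist (fst p) x < r" using dist_fst_le[of p "(x, y)"] by simp
    then show "fst (x, y) \<in> (\<Union>x\<in>fst ` X. ball x r)" using p(1) by auto
  qed
  then have "covering_number r (fst ` E) \<le> card (fst ` X)"
    using X(1) by (intro covering_number_le) auto
  also have "\<dots> \<le> card X" using X(1) by (rule card_image_le)
  finally show ?thesis using X(2) by simp
qed

text \<open>At scale \<open>r\<close> a planar set of height at most \<open>r\<close> is one-dimensional: centred at
  mid-height, a ball of radius \<open>r\<close> contains the product of an interval of radius \<open>r / 2\<close> with the whole height.\<close>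
lemma covering_number_strip_le:
  fixes E :: "(real \<times> real) set"
  assumes "bounded E" "0 < r" "\<And>p. p \<in> E \<Longrightarrow> y \<le> snd p \<and> snd p \<le> y + r"
  shows "covering_number r E \<le> covering_number (r / 2) (fst ` E)"
proof -
  obtain X where X: "finite X" "card X = covering_number (r / 2) (fst ` E)"
      "fst ` E \<subseteq> (\<Union>x\<in>X. ball x (r / 2))"
    using covering_number_witness[of "fst ` E" "r / 2"] assms by (auto simp: bounded_fst)
  have "E \<subseteq> (\<Union>p\<in>(\<lambda>x. (x, y + r / 2)) ` X. ball p r)"
  proof
    fix p assume p: "p \<in> E"
    then obtain x where x: "x \<in> X" "dist x (fst p) < r / 2" using X(3) by fastforce
    have "dist (y + r / 2) (snd p) \<le> r / 2" using assms(3)[OF p] by (auto simp: dist_real_def abs_if)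
    moreover have "dist (x, y + r / 2) p \<le> dist x (fst p) + dist (y + r / 2) (snd p)"
      by (cases p) (simp add: dist_prod_def sqrt_sum_squares_le_sum)
    ultimately have "dist (x, y + r / 2) p < r" using x(2) by linarith
    then show "p \<in> (\<Union>p\<in>(\<lambda>x. (x, y + r / 2)) ` X. ball p r)" using x(1) by auto
  qed
  then have "covering_number r E \<le> card ((\<lambda>x. (x, y + r / 2)) ` X)"
    using X(1) by (intro covering_number_le) auto
  also have "\<dots> \<le> card X" using X(1) by (rule card_image_le)
  finally show ?thesis using X(2) by simp
qed

section \<open>Assouad and Frostman exponents\<close>

definition assouad_exponent :: "'a::euclidean_space set \<Rightarrow> real \<Rightarrow> bool" where
  "assouad_exponent F e \<longleftrightarrow> 0 \<le> e \<and> (\<exists>C>0. \<forall>r R. 0 < r \<and> r \<le> R \<and> R \<le> 1 \<longrightarrow>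
       (\<forall>x\<in>F. real (covering_number r (F \<inter> ball x R)) \<le> C * (R / r) powr e))"

definition frostman_exponent :: "real measure \<Rightarrow> real \<Rightarrow> bool" where
  "frostman_exponent \<nu> t \<longleftrightarrow>
     0 \<le> t \<and> (\<exists>C>0. \<forall>r\<in>{0<..<1}. \<forall>z. measure \<nu> (ball z r) \<le> C * r powr t)"

lemma assouad_dim_eq: "assouad_dim F = Inf {e. assouad_exponent F e}"
  by (simp add: assouad_dim_def assouad_exponent_def)

lemma frostman_dim_eq: "frostman_dim \<nu> = Sup {t. frostman_exponent \<nu> t}"
  by (simp add: frostman_dim_def frostman_exponent_def)

lemma covering_number_subset_ball_le:
  fixes E :: "real set"
  assumes "0 < r" "r \<le> R" "E \<subseteq> ball x R"
  shows "real (covering_number r E) \<le> 4 * (R / r)"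
proof -
  define N where "N = nat \<lceil>2 * R / r\<rceil>"
  define X where "X = (\<lambda>j. x - R + real j * r) ` {..N}"
  have R: "1 \<le> R / r" using assms by simp
  have "E \<subseteq> (\<Union>y\<in>X. ball y r)"
  proof
    fix p assume "p \<in> E"
    then have p: "\<bar>p - x\<bar> < R" using assms(3) by (auto simp: dist_real_def)
    define j where "j = nat \<lfloor>(p - x + R) / r\<rfloor>"
    have nn: "0 \<le> (p - x + R) / r" using p assms(1) by simp
    then have j: "real j \<le> (p - x + R) / r" "(p - x + R) / r < real j + 1"
      unfolding j_def by linarith+
    have "(p - x + R) / r \<le> 2 * R / r" using p assms(1) by (intro divide_right_mono) auto
    then have "real j \<le> real N" using j(1) unfolding N_def by linarith
    moreover have "real j * r \<le> p - x + R" "p - x + R < real j * r + r"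
      using j assms(1) by (simp_all add: field_simps)
    ultimately show "p \<in> (\<Union>y\<in>X. ball y r)"
      unfolding X_def by (auto simp: dist_real_def abs_if intro!: bexI[of _ j])
  qed
  then have "covering_number r E \<le> card X"
    by (intro covering_number_le) (auto simp: X_def)
  also have "card X \<le> N + 1" unfolding X_def using card_image_le[of "{..N}"] by simp
  finally have "covering_number r E \<le> N + 1" .
  moreover have "real N \<le> 2 * (R / r) + 1" using R unfolding N_def by linarith
  ultimately show ?thesis using R by linarith
qed

lemma assouad_exponent_1: "assouad_exponent (F :: real set) 1"
  unfolding assouad_exponent_def
proof (intro conjI exI[of _ 4] allI impI ballI)
  fix r R x :: real assume "0 < r \<and> r \<le> R \<and> R \<le> 1"
  then show "real (covering_number r (F \<inter> ball x R)) \<le> 4 * (R / r) powr 1"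
    using covering_number_subset_ball_le[of r R "F \<inter> ball x R" x] by simp
qed auto

text \<open>Windows obtained by rescaling are neither centred in \<open>F\<close> nor constrained by \<open>r \<le> R \<le> 1\<close>. For
  \<open>F\<close> in the unit interval these restrictions cost only a constant: recentring doubles the
  radius, and for large radii \<open>F\<close> is cut at its middle, each half lying in an open ball of radius 1.\<close>
lemma assouad_exponent_uniform:
  fixes F :: "real set"
  assumes "assouad_exponent F e" "F \<subseteq> {0..1}"
  obtains C where "0 < C"
    "\<And>r R z. 0 < r \<Longrightarrow> 0 < R \<Longrightarrow>
       real (covering_number r (F \<inter> ball z R)) \<le> C * (max 1 (min R 1 / r)) powr e"
proof -
  from assms(1) obtain C where e: "0 \<le> e" and C: "0 < C"
    "\<And>r R x. 0 < r \<Longrightarrow> r \<le> R \<Longrightarrow> R \<le> 1 \<Longrightarrow> x \<in> F \<Longrightarrow>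
       real (covering_number r (F \<inter> ball x R)) \<le> C * (R / r) powr e"
    unfolding assouad_exponent_def by blast
  have bF: "bounded E" if "E \<subseteq> F" for E
    using that assms(2) by (meson bounded_closed_interval bounded_subset order_trans)
  have local: "real (covering_number r (F \<inter> ball x R)) \<le> (1 + C) * (max 1 (R / r)) powr e"
    if "0 < r" "R \<le> 1" "x \<in> F" for r R x
  proof (cases "r \<le> R")
    case True
    then have "max 1 (R / r) = R / r" using that by simp
    then show ?thesis using C(2)[OF that(1) True that(2,3)] 
      by (simp add: algebra_simps add_increasing)
  next
    case False
    then have "F \<inter> ball x R \<subseteq> ball x r" by auto
    then have "covering_number r (F \<inter> ball x R) \<le> 1"
      using covering_number_le[of "{x}" "F \<inter> ball x R" r] by simp
    then have "real (covering_number r (F \<inter> ball x R)) \<le> 1 * 1" by simp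
    also have "\<dots> \<le> (1 + C) * (max 1 (R / r)) powr e"
      using C(1) e by (intro mult_mono ge_one_powr_ge_zero) auto
    finally show ?thesis .
  qed
  have half: "real (covering_number r (F \<inter> ball y 1 \<inter> E)) \<le> (1 + C) * (max 1 (1 / r)) powr e"
    if "0 < r" "y \<in> F" for r y E
    using local[OF that(1) order_refl that(2)]
      covering_number_mono[of "F \<inter> ball y 1 \<inter> E" "F \<inter> ball y 1" r] bF that(1)
    by (smt (verit) inf_le1 of_nat_mono)
  have piece: "real (covering_number r E) \<le> (1 + C) * (max 1 (1 / r)) powr e"
    if "0 < r" "E \<subseteq> F" "\<And>x y. x \<in> E \<Longrightarrow> y \<in> E \<Longrightarrow> dist x y < 1" for r E
  proof (cases "E = {}")
    case True
    then show ?thesis using C(1) by simp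
  next
    case False
    then obtain y where y: "y \<in> E" by auto
    then have "F \<inter> ball y 1 \<inter> E = E" using that by auto
    then show ?thesis using half[of r y E] y that by auto
  qed
  have big: "real (covering_number r F) \<le> 2 * (1 + C) * (max 1 (1 / r)) powr e" if r: "0 < r" for r
  proof -
    have F: "F = (\<Union>E\<in>{F \<inter> {0..1/2}, F \<inter> {1/2..1}}. E)" using assms(2) by (auto simp: subset_eq)
    have "covering_number r F \<le> (\<Sum>E\<in>{F \<inter> {0..1/2}, F \<inter> {1/2..1}}. covering_number r E)"
      by (subst F, rule covering_number_UN_le) (use r bF in auto)
    also have "\<dots> \<le> covering_number r (F \<inter> {0..1/2}) + covering_number r (F \<inter> {1/2..1})"
      by (cases "F \<inter> {0..1/2} = F \<inter> {1/2..1}") auto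
    finally have "real (covering_number r F) \<le> real (covering_number r (F \<inter> {0..1/2}))
        + real (covering_number r (F \<inter> {1/2..1}))" by linarith
    moreover have "real (covering_number r (F \<inter> {0..1/2})) \<le> (1 + C) * (max 1 (1 / r)) powr e"
      "real (covering_number r (F \<inter> {1/2..1})) \<le> (1 + C) * (max 1 (1 / r)) powr e"
      by (rule piece[OF r]; auto simp: dist_real_def abs_if)+
    ultimately show ?thesis by (simp add: algebra_simps)
  qed
  define D where "D = 2 * (1 + C) * 2 powr e"
  have "real (covering_number r (F \<inter> ball z R)) \<le> D * (max 1 (min R 1 / r)) powr e"
    if rR: "0 < r" "0 < R" for r R z
  proof (cases "F \<inter> ball z R = {}")
    case True
    then show ?thesis using C(1) by (simp add: D_def)
  next
    case False
    then obtain y where y: "y \<in> F" "dist z y < R" by auto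
    have sub: "F \<inter> ball z R \<subseteq> F \<inter> ball y (2 * R)"
    proof
      fix p assume "p \<in> F \<inter> ball z R"
      then show "p \<in> F \<inter> ball y (2 * R)" using y(2) dist_triangle[of y p z]
        by (auto simp: dist_commute)
    qed
    have scale: "(max 1 (k / r)) powr e \<le> 2 powr e * (max 1 (min R 1 / r)) powr e"
      if "k \<le> 2 * min R 1" for k
    proof -
      have "k / r \<le> 2 * (min R 1 / r)" using that rR divide_right_mono[of k "2 * min R 1" r] by simp
      then have "max 1 (k / r) \<le> 2 * max 1 (min R 1 / r)" by linarith
      then show ?thesis using e by (simp flip: powr_mult add: powr_mono2)
    qed
    show ?thesis
    proof (cases "2 * R \<le> 1")
      case True
      have "real (covering_number r (F \<inter> ball z R)) \<le> real (covering_number r (F \<inter> ball y (2 * R)))"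
        using covering_number_mono[OF sub] bF rR(1) by simp
      also have "\<dots> \<le> (1 + C) * (max 1 (2 * R / r)) powr e" using local[OF rR(1) True y(1)] .
      also have "\<dots> \<le> 2 * (1 + C) * (2 powr e * (max 1 (min R 1 / r)) powr e)"
        using scale[of "2 * R"] True rR C(1) by (intro mult_mono) auto
      finally show ?thesis by (simp add: D_def mult.assoc)
    next
      case False
      have "real (covering_number r (F \<inter> ball z R)) \<le> real (covering_number r F)"
        using covering_number_mono[of "F \<inter> ball z R" F] bF rR(1) by simp
      also have "\<dots> \<le> 2 * (1 + C) * (max 1 (1 / r)) powr e" using big[OF rR(1)] .
      also have "\<dots> \<le> 2 * (1 + C) * (2 powr e * (max 1 (min R 1 / r)) powr e)"
        using scale[of 1] False C(1) by (intro mult_mono) auto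
      finally show ?thesis by (simp add: D_def mult.assoc)
    qed
  qed
  moreover have "0 < D" using C(1) by (simp add: D_def)
  ultimately show thesis using that by blast
qed

section \<open>Words and cylinders of the carpet\<close>

text \<open>The translation part of the composition of the maps \<open>x \<mapsto> g x + c i\<close> along a word. The two coordinates
  of a cylinder use it with \<open>(g, c) = (\<beta>, b)\<close> and \<open>(\<alpha>, a)\<close>.\<close>
primrec word_offset :: "real \<Rightarrow> ('i \<Rightarrow> real) \<Rightarrow> 'i list \<Rightarrow> real" where
  "word_offset g c [] = 0"
| "word_offset g c (i # u) = c i + g * word_offset g c u"

lemma word_offset_append:
  "word_offset g c (u @ v) = word_offset g c u + g ^ length u * word_offset g c v"
  by (induction u) (simp_all add: algebra_simps)

lemma word_offset_nonneg:
  assumes "0 \<le> g" "\<And>i. i \<in> I \<Longrightarrow> 0 \<le> c i" "set u \<subseteq> I"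
  shows "0 \<le> word_offset g c u"
  using assms(3) by (induction u) (auto simp: assms(1,2))

lemma word_offset_le:
  assumes "0 \<le> g" "\<And>i. i \<in> I \<Longrightarrow> c i \<le> 1 - g" "set u \<subseteq> I"
  shows "word_offset g c u \<le> 1 - g ^ length u"
  using assms(3)
proof (induction u)
  case (Cons i u)
  then have "g * word_offset g c u \<le> g * (1 - g ^ length u)" "c i \<le> 1 - g"
    using assms(1,2) by (auto intro: mult_left_mono)
  then show ?case by (simp add: algebra_simps)
qed simp

definition words :: "'i set \<Rightarrow> nat \<Rightarrow> 'i list set" where
  "words I n = {u. set u \<subseteq> I \<and> length u = n}"

lemma finite_words: "finite I \<Longrightarrow> finite (words I n)"
  unfolding words_def by (rule finite_lists_length_eq)

lemma card_words: "finite I \<Longrightarrow> card (words I n) = card I ^ n"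
  unfolding words_def by (rule card_lists_length_eq)

lemma words_0 [simp]: "words I 0 = {[]}"
  by (auto simp: words_def)

lemma words_Suc: "words I (Suc n) = (\<lambda>(i, u). i # u) ` (I \<times> words I n)"
  by (force simp: words_def length_Suc_conv image_iff)

lemma words_append: "u \<in> words I l \<Longrightarrow> v \<in> words I n \<Longrightarrow> u @ v \<in> words I (l + n)"
  by (auto simp: words_def)

lemma words_add: "words I (l + n) = (\<lambda>(u, v). u @ v) ` (words I l \<times> words I n)"
proof
  show "words I (l + n) \<subseteq> (\<lambda>(u, v). u @ v) ` (words I l \<times> words I n)"
  proof
    fix w assume "w \<in> words I (l + n)"
    then have "take l w \<in> words I l" "drop l w \<in> words I n"
      by (auto simp: words_def dest: in_set_takeD in_set_dropD)
    then show "w \<in> (\<lambda>(u, v). u @ v) ` (words I l \<times> words I n)"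
      by (intro image_eqI[of _ _ "(take l w, drop l w)"]) auto
  qed
qed (auto simp: words_append)

text \<open>The last assumption is the disjointness of the open boxes \<open>T\<^sub>i((0,1)\<^sup>2)\<close>, expressed by their corners.\<close>
locale carpet =
  fixes \<alpha> \<beta> :: real and I :: "'i set" and a b :: "'i \<Rightarrow> real" and K :: "(real \<times> real) set"
  assumes alpha_pos: "0 < \<alpha>" and alpha_beta: "\<alpha> < \<beta>" and beta_1: "\<beta> < 1"
    and fin: "finite I" and ne: "I \<noteq> {}"
    and b_range: "\<And>i. i \<in> I \<Longrightarrow> 0 \<le> b i \<and> b i \<le> 1 - \<beta>"
    and a_range: "\<And>i. i \<in> I \<Longrightarrow> 0 \<le> a i \<and> a i \<le> 1 - \<alpha>"
    and K_compact: "compact K" and K_ne: "K \<noteq> {}"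
    and K_eq: "K = (\<Union>i\<in>I. (\<lambda>p. (\<beta> * fst p + b i, \<alpha> * snd p + a i)) ` K)"
    and disjoint: "\<And>i j. i \<in> I \<Longrightarrow> j \<in> I \<Longrightarrow> i \<noteq> j \<Longrightarrow> \<beta> \<le> \<bar>b i - b j\<bar> \<or> \<alpha> \<le> \<bar>a i - a j\<bar>"
begin

lemma parameter_bounds: "0 < \<beta>" "\<alpha> < 1" "0 < card I"
  using alpha_pos alpha_beta beta_1 fin ne by (auto simp: card_gt_0_iff)

definition T :: "'i list \<Rightarrow> real \<times> real \<Rightarrow> real \<times> real" where
  "T u p = (\<beta> ^ length u * fst p + word_offset \<beta> b u, \<alpha> ^ length u * snd p + word_offset \<alpha> a u)"

lemma T_append: "T (u @ v) p = T u (T v p)"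
  by (simp add: T_def word_offset_append power_add algebra_simps)

lemma K_words: "K = (\<Union>u\<in>words I n. T u ` K)"
proof (induction n)
  case 0
  then show ?case by (simp add: T_def)
next
  case (Suc n)
  have step: "T (i # u) p = (\<beta> * fst (T u p) + b i, \<alpha> * snd (T u p) + a i)" for i u p
    by (simp add: T_def algebra_simps)
  have "K = (\<Union>i\<in>I. (\<lambda>p. (\<beta> * fst p + b i, \<alpha> * snd p + a i)) ` (\<Union>u\<in>words I n. T u ` K))"
    using K_eq Suc by simp
  also have "\<dots> = (\<Union>u\<in>words I (Suc n). T u ` K)"
    by (auto simp: words_Suc step image_UN image_image) blast+
  finally show ?case .
qed

lemma T_in_K: "u \<in> words I n \<Longrightarrow> p \<in> K \<Longrightarrow> T u p \<in> K"
  using K_words[of n] by blast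

text \<open>Apply the invariance of \<open>K\<close> at a point where the coordinate is extremal: its maximum \<open>M\<close> satisfies
  \<open>M \<le> g M + (1 - g)\<close>, and likewise with \<open>1 - f\<close> for the minimum.\<close>
lemma K_unit:
  assumes "p \<in> K"
  shows "0 \<le> fst p" "fst p \<le> 1" "0 \<le> snd p" "snd p \<le> 1"
proof -
  have rep: "\<exists>q\<in>K. \<exists>i\<in>I. fst p = \<beta> * fst q + b i \<and> snd p = \<alpha> * snd q + a i" if pK: "p \<in> K" for p
  proof -
    obtain i q where "i \<in> I" "q \<in> K" "p = (\<beta> * fst q + b i, \<alpha> * snd q + a i)"
      using subsetD[OF equalityD1[OF K_eq] pK] by blast
    then show ?thesis by auto
  qed
  have up: "f p \<le> 1" if f: "continuous_on K f" 
    and g: "g < 1" and r: "\<And>p. p \<in> K \<Longrightarrow> \<exists>q\<in>K. f p \<le> g * f q + (1 - g)" "0 < g" for f :: "real \<times> real \<Rightarrow> real" and g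
  proof -
    obtain q where q: "q \<in> K" "\<forall>p\<in>K. f p \<le> f q"
      using continuous_attains_sup[OF K_compact K_ne f] by blast
    then obtain q' where "q' \<in> K" "f q \<le> g * f q' + (1 - g)" using r(1) by blast
    then have "f q \<le> g * f q + (1 - g)" using q r(2) by (smt (verit) mult_left_mono)
    then have "(1 - g) * f q \<le> (1 - g) * 1" by (simp add: algebra_simps)
    then have "f q \<le> 1" using g by simp
    then show ?thesis using q assms by force
  qed
  have ex: "\<exists>q\<in>K. f p \<le> g * f q + (1 - g)"
    if "p \<in> K" "\<And>q i. q \<in> K \<Longrightarrow> i \<in> I \<Longrightarrow> fst p = \<beta> * fst q + b i \<Longrightarrow>
          snd p = \<alpha> * snd q + a i \<Longrightarrow> f p \<le> g * f q + (1 - g)" for f :: "real \<times> real \<Rightarrow> real" and g p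
    using rep[OF that(1)] that(2) by blast
  show "fst p \<le> 1"
    by (rule up[where g = \<beta>]) (use b_range parameter_bounds beta_1 in \<open>auto intro!: continuous_intros ex\<close>)
  show "snd p \<le> 1"
    by (rule up[where g = \<alpha>]) (use a_range parameter_bounds alpha_pos in \<open>auto intro!: continuous_intros ex\<close>)
  have "1 - fst p \<le> 1"
  proof (rule up[where f = "\<lambda>p. 1 - fst p" and g = \<beta>])
    show "\<exists>q\<in>K. 1 - fst p \<le> \<beta> * (1 - fst q) + (1 - \<beta>)" if "p \<in> K" for p
      using that by (rule ex[where f = "\<lambda>p. 1 - fst p"]) (use b_range in \<open>simp add: algebra_simps\<close>)
  qed (use parameter_bounds beta_1 alpha_pos in \<open>auto intro!: continuous_intros\<close>)
  then show "0 \<le> fst p" by simp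
  have "1 - snd p \<le> 1"
  proof (rule up[where f = "\<lambda>p. 1 - snd p" and g = \<alpha>])
    show "\<exists>q\<in>K. 1 - snd p \<le> \<alpha> * (1 - snd q) + (1 - \<alpha>)" if "p \<in> K" for p
      using that by (rule ex[where f = "\<lambda>p. 1 - snd p"]) (use a_range in \<open>simp add: algebra_simps\<close>)
  qed (use parameter_bounds beta_1 alpha_pos in \<open>auto intro!: continuous_intros\<close>)
  then show "0 \<le> snd p" by simp
qed

text \<open>The first letter in which the words differ separates the boxes in one coordinate; the
  remaining letters move the corners within boxes of that level, which leaves a gap of \<open>g ^ n\<close>.\<close>
lemma offsets_separated:
  assumes "u \<in> words I n" "v \<in> words I n" "u \<noteq> v"
  shows "\<beta> ^ n \<le> \<bar>word_offset \<beta> b u - word_offset \<beta> b v\<bar> \<or>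
         \<alpha> ^ n \<le> \<bar>word_offset \<alpha> a u - word_offset \<alpha> a v\<bar>"
  using assms
proof (induction n arbitrary: u v)
  case (Suc n)
  obtain i u' j v' where u: "u = i # u'" "i \<in> I" "u' \<in> words I n"
    and v: "v = j # v'" "j \<in> I" "v' \<in> words I n"
    using Suc.prems(1,2) by (auto simp: words_Suc)
  have far: "g ^ Suc n \<le> \<bar>word_offset g c u - word_offset g c v\<bar>"
    if g: "0 < g" and c: "\<And>i. i \<in> I \<Longrightarrow> 0 \<le> c i \<and> c i \<le> 1 - g" and "g \<le> \<bar>c i - c j\<bar>" for g and c :: "'i \<Rightarrow> real"
  proof -
    have "0 \<le> word_offset g c w \<and> word_offset g c w \<le> 1 - g ^ n" if "w \<in> words I n" for w
      using that c g word_offset_nonneg[of g I c w] word_offset_le[of g I c w]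
      by (auto simp: words_def)
    then have "g * word_offset g c w \<ge> 0 \<and> g * word_offset g c w \<le> g - g ^ Suc n"
      if "w \<in> words I n" for w
      using that g mult_left_mono[of "word_offset g c w" "1 - g ^ n" g]
      by (auto simp: algebra_simps)
    from this[OF u(3)] this[OF v(3)] show ?thesis
      using that(3) by (simp add: u v) linarith
  qed
  show ?case
  proof (cases "i = j")
    case True
    then have "u' \<noteq> v'" using Suc.prems(3) u v by simp
    have same: "\<bar>word_offset g c u - word_offset g c v\<bar> = g * \<bar>word_offset g c u' - word_offset g c v'\<bar>"
      if "0 < g" for g and c :: "'i \<Rightarrow> real"
      using that True by (simp add: u v flip: abs_mult_pos' right_diff_distrib)
    show ?thesis
      using Suc.IH[OF u(3) v(3) \<open>u' \<noteq> v'\<close>] same[OF parameter_bounds(1)] same[OF alpha_pos]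
        parameter_bounds(1) alpha_pos by simp
  next
    case False
    then show ?thesis
      using disjoint[OF u(2) v(2)] far[of \<beta> b] far[of \<alpha> a] b_range a_range parameter_bounds(1) alpha_pos
      by blast
  qed
qed simp

text \<open>A combinatorial form of comparing areas: rounding the lower left corners to a grid of mesh
  \<open>\<beta> ^ n \<times> \<alpha> ^ n\<close> is injective by separation, and the corners of boxes meeting the ball occupy a
  \<open>3 \<times> 3\<close> block of grid cells.\<close>
lemma words_meeting_ball_le:
  assumes "r \<le> \<alpha> ^ n"
  shows "card {u \<in> words I n. T u ` ({0..1} \<times> {0..1}) \<inter> ball p r \<noteq> {}} \<le> 9"
proof -
  let ?U = "{u \<in> words I n. T u ` ({0..1} \<times> {0..1}) \<inter> ball p r \<noteq> {}}"
  define f where "f u = (\<lfloor>(word_offset \<beta> b u - fst p) / \<beta> ^ n\<rfloor>, \<lfloor>(word_offset \<alpha> a u - snd p) / \<alpha> ^ n\<rfloor>)" for u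
  have ab: "\<alpha> ^ n \<le> \<beta> ^ n" using alpha_pos alpha_beta by (intro power_mono) auto
  have flo: "\<lfloor>(o' - q) / h\<rfloor> \<in> {-2..0}" 
    if "0 < h" "r \<le> h" "0 \<le> x" "x \<le> 1" "\<bar>h * x + o' - q\<bar> < r" for o' q h x :: real
  proof -
    have "0 \<le> h * x" "h * x \<le> h" using that by (auto simp: mult_left_le)
    then have "o' - q < 1 * h" "- 2 * h < o' - q" using that by linarith+
    then have "(o' - q) / h < 1" "-2 < (o' - q) / h"
      using that(1) by (simp_all only: pos_divide_less_eq pos_less_divide_eq)
    then show ?thesis by (auto simp: floor_less_iff le_floor_iff)
  qed
  have "f u \<in> {-2..0} \<times> {-2..0}" if uU: "u \<in> ?U" for u
  proof -
    obtain q where q: "q \<in> {0..1} \<times> {0..1}" "T u q \<in> ball p r" using uU by blast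
    define x y where "x = fst q" "y = snd q"
    then have xy: "0 \<le> x" "x \<le> 1" "0 \<le> y" "y \<le> 1" "dist p (T u (x, y)) < r"
      and u: "length u = n"
      using q uU by (auto simp: words_def mem_Times_iff)
    then have "\<bar>\<beta> ^ n * x + word_offset \<beta> b u - fst p\<bar> < r" 
      "\<bar>\<alpha> ^ n * y + word_offset \<alpha> a u - snd p\<bar> < r"
      using dist_fst_le[of p "T u (x, y)"] dist_snd_le[of p "T u (x, y)"]
      by (auto simp: T_def dist_real_def)
    then show ?thesis
      using flo xy assms ab parameter_bounds(1) alpha_pos by (simp add: f_def)
  qed
  then have "f ` ?U \<subseteq> {-2..0} \<times> {-2..0}" by blast
  moreover have "inj_on f ?U"
  proof (rule inj_onI, rule ccontr)
    fix u v assume uv: "u \<in> ?U" "v \<in> ?U" "f u = f v" "u \<noteq> v"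
    have "\<bar>x - y\<bar> < h" if "\<lfloor>(x - q) / h\<rfloor> = \<lfloor>(y - q) / h\<rfloor>" "0 < h" for x y q h :: real
    proof -
      have "\<bar>(x - q) / h - (y - q) / h\<bar> < 1" using that(1) by linarith
      then have "\<bar>(x - y) / h\<bar> < 1" by (simp flip: diff_divide_distrib)
      then show ?thesis using that(2) by simp
    qed
    then show False
      using uv offsets_separated[of u n v] parameter_bounds(1) alpha_pos by (fastforce simp: f_def)
  qed
  ultimately have "card ?U \<le> card ({-2..0::int} \<times> {-2..0::int})"
    by (intro card_inj_on_le[of f] finite_cartesian_product finite_atLeastAtMost_int)
  then show ?thesis by simp
qed

end

section \<open>Word counts and the self-similar measure\<close>

lemma one_le_ratio:
  fixes q C :: real
  assumes "0 \<le> q" "\<And>n. 1 \<le> C * q ^ n"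
  shows "1 \<le> q"
proof (rule ccontr)
  assume "\<not> 1 \<le> q"
  then have "(\<lambda>n. C * q ^ n) \<longlonglongrightarrow> C * 0"
    using assms(1) by (intro tendsto_mult tendsto_const LIMSEQ_realpow_zero) auto
  then have "1 \<le> C * 0" by (rule LIMSEQ_le_const) (use assms(2) in auto)
  then show False by simp
qed

lemma powr_power_swap: "0 < x \<Longrightarrow> (x ^ n) powr t = (x powr t) ^ n" for x t :: real
  by (simp add: powr_powr mult.commute flip: powr_realpow)

locale carpet_measure = carpet +
  fixes \<nu> :: "real measure"
  assumes self_similar: "is_uniform_self_similar_measure I (\<lambda>i x. \<beta> * x + b i) \<nu>"
begin

abbreviation m :: real where "m \<equiv> real (card I)"

abbreviation off :: "'a list \<Rightarrow> real" where "off \<equiv> word_offset \<beta> b"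

lemma prob: "prob_space \<nu>" and sets_nu: "sets \<nu> = sets borel"
  and invariant: "A \<in> sets borel \<Longrightarrow>
    measure \<nu> A = (\<Sum>i\<in>I. 1 / m * measure \<nu> ((\<lambda>x. \<beta> * x + b i) -` A))"
  using self_similar unfolding is_uniform_self_similar_measure_def by blast+

sublocale prob_space \<nu> by (rule prob)

lemma m_pos: "0 < m" using parameter_bounds by simp

lemma vimage_affine_borel [measurable]: "A \<in> sets borel \<Longrightarrow> (\<lambda>x::real. g * x + c) -` A \<in> sets borel"
  using measurable_sets[of "\<lambda>x::real. g * x + c" borel borel A] by simp

lemma invariant_words:
  assumes "A \<in> sets borel"
  shows "measure \<nu> A = (\<Sum>u\<in>words I n. measure \<nu> ((\<lambda>x. \<beta> ^ n * x + off u) -` A)) / m ^ n"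
  using assms
proof (induction n arbitrary: A)
  case (Suc n)
  have inj: "inj_on (\<lambda>(i, u). i # u) (I \<times> words I n)" by (auto simp: inj_on_def)
  have pre: "(\<lambda>x. \<beta> ^ n * x + off u) -` (\<lambda>x. \<beta> * x + b i) -` A =
      (\<lambda>x. \<beta> ^ Suc n * x + off (i # u)) -` A" for i u
    by (auto simp: algebra_simps)
  have "measure \<nu> A = (\<Sum>i\<in>I. 1 / m * measure \<nu> ((\<lambda>x. \<beta> * x + b i) -` A))"
    using invariant[OF Suc.prems] .
  also have "\<dots> = (\<Sum>i\<in>I. 1 / m * ((\<Sum>u\<in>words I n.
      measure \<nu> ((\<lambda>x. \<beta> ^ n * x + off u) -` (\<lambda>x. \<beta> * x + b i) -` A)) / m ^ n))"
    using Suc.IH[OF vimage_affine_borel[OF Suc.prems]] by (intro sum.cong refl) simp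
  also have "\<dots> = (\<Sum>i\<in>I. \<Sum>u\<in>words I n. measure \<nu> ((\<lambda>x. \<beta> ^ Suc n * x + off (i # u)) -` A))
      / m ^ Suc n"
    unfolding pre by (simp add: sum_divide_distrib mult.commute)
  also have "(\<Sum>i\<in>I. \<Sum>u\<in>words I n. measure \<nu> ((\<lambda>x. \<beta> ^ Suc n * x + off (i # u)) -` A)) =
      (\<Sum>w\<in>words I (Suc n). measure \<nu> ((\<lambda>x. \<beta> ^ Suc n * x + off w) -` A))"
    unfolding words_Suc sum.reindex[OF inj] by (simp add: sum.cartesian_product case_prod_unfold)
  finally show ?case .
qed simp

text \<open>Pulling back under a map of the system enlarges \<open>[-M, 1 + M]\<close> to at least \<open>[-M / \<beta>, 1 + M / \<beta>]\<close>,
  so by invariance all these intervals have the same mass. A bounded set of full measure lets masses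
  of balls be compared with word counts.\<close>
lemma measure_core: "measure \<nu> {-1..2} = 1"
proof -
  define p where "p M = measure \<nu> {-M..1+M}" for M
  have space: "space \<nu> = UNIV" using sets_eq_imp_space_eq[OF sets_nu] by simp
  have mono: "p (M / \<beta>) \<le> p M" if M: "0 < M" for M
  proof -
    have sub: "{-(M / \<beta>)..1 + M / \<beta>} \<subseteq> (\<lambda>x. \<beta> * x + b i) -` {-M..1+M}" if "i \<in> I" for i
    proof
      fix x assume "x \<in> {-(M / \<beta>)..1 + M / \<beta>}"
      then have "\<beta> * (-(M / \<beta>)) \<le> \<beta> * x" "\<beta> * x \<le> \<beta> * (1 + M / \<beta>)"
        using parameter_bounds(1) mult_left_mono[of "-(M / \<beta>)" x \<beta>] by (auto intro!: mult_left_mono)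
      then show "x \<in> (\<lambda>x. \<beta> * x + b i) -` {-M..1+M}"
        using b_range[OF that] parameter_bounds(1) by (simp add: algebra_simps)
    qed
    have "p (M / \<beta>) = (\<Sum>i\<in>I. 1 / m * p (M / \<beta>))" using m_pos by simp
    also have "\<dots> \<le> (\<Sum>i\<in>I. 1 / m * measure \<nu> ((\<lambda>x. \<beta> * x + b i) -` {-M..1+M}))"
      unfolding p_def
      by (intro sum_mono mult_left_mono finite_measure_mono sub) (auto simp: sets_nu)
    also have "\<dots> = p M" unfolding p_def by (rule invariant[symmetric]) simp
    finally show ?thesis .
  qed
  have low: "p (real n) \<le> p 1" for n
  proof -
    have iter: "p (1 / \<beta> ^ k) \<le> p 1" for k
    proof (induction k)
      case (Suc k)
      have "p (1 / \<beta> ^ k / \<beta>) \<le> p (1 / \<beta> ^ k)" by (rule mono) (use parameter_bounds(1) in simp)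
      then show ?case using Suc by (simp add: mult.commute)
    qed simp
    obtain k where "real n < (1 / \<beta>) ^ k"
      using real_arch_pow[of "1 / \<beta>" "real n"] beta_1 parameter_bounds(1) by auto
    then have "p (real n) \<le> p (1 / \<beta> ^ k)"
      unfolding p_def by (intro finite_measure_mono) (auto simp: sets_nu power_divide)
    then show ?thesis using iter[of k] by linarith
  qed
  have "(\<lambda>n. p (real n)) \<longlonglongrightarrow> measure \<nu> (\<Union>n. {- real n..1 + real n})"
    unfolding p_def
    by (rule finite_Lim_measure_incseq) (auto simp: sets_nu incseq_def)
  moreover have "(\<Union>n. {- real n..1 + real n}) = UNIV"
  proof -
    have "x \<in> (\<Union>n. {- real n..1 + real n})" for x :: real
    proof -
      obtain n where "\<bar>x\<bar> \<le> real n" using real_arch_simple by blast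
      then show ?thesis by (auto intro!: exI[of _ n])
    qed
    then show ?thesis by blast
  qed
  ultimately have "(\<lambda>n. p (real n)) \<longlonglongrightarrow> 1" using prob_space space by simp
  then have "1 \<le> p 1" by (rule LIMSEQ_le_const2) (use low in auto)
  then show ?thesis using prob_le_1[of "{-1..2}"] by (simp add: p_def)
qed

text \<open>This bound and the next one sandwich the number of cylinders near a point between masses of
  comparable balls, for \<open>\<nu>\<close> gives mass \<open>1 / m ^ n\<close> to each word of length \<open>n\<close>.\<close>
lemma card_offsets_le:
  "real (card {u \<in> words I n. \<bar>off u - z\<bar> \<le> \<rho>}) \<le> m ^ n * measure \<nu> (ball z (\<rho> + 3 * \<beta> ^ n))"
proof -
  let ?U = "{u \<in> words I n. \<bar>off u - z\<bar> \<le> \<rho>}"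
  let ?B = "ball z (\<rho> + 3 * \<beta> ^ n)"
  let ?f = "\<lambda>u. measure \<nu> ((\<lambda>x. \<beta> ^ n * x + off u) -` ?B)"
  have bn: "0 < \<beta> ^ n" using parameter_bounds(1) by simp
  have one: "1 \<le> ?f u" if "u \<in> ?U" for u
  proof -
    have "{-1..2} \<subseteq> (\<lambda>x. \<beta> ^ n * x + off u) -` ?B"
    proof
      fix x :: real assume "x \<in> {-1..2}"
      then have "\<beta> ^ n * (-1) \<le> \<beta> ^ n * x" "\<beta> ^ n * x \<le> \<beta> ^ n * 2"
        using bn mult_left_mono[of "-1" x "\<beta> ^ n"] by auto
      moreover have "\<bar>off u - z\<bar> \<le> \<rho>" using that by simp
      ultimately have "\<bar>z - (\<beta> ^ n * x + off u)\<bar> < \<rho> + 3 * \<beta> ^ n" using bn by linarith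
      then show "x \<in> (\<lambda>x. \<beta> ^ n * x + off u) -` ?B" by (simp add: dist_real_def)
    qed
    then have "measure \<nu> {-1..2} \<le> ?f u"
      by (intro finite_measure_mono) (auto simp: sets_nu)
    then show ?thesis using measure_core by simp
  qed
  have "real (card ?U) \<le> (\<Sum>u\<in>?U. ?f u)" using sum_mono[of ?U "\<lambda>_. 1" ?f] one by simp
  also have "\<dots> \<le> (\<Sum>u\<in>words I n. ?f u)"
    by (intro sum_mono2 finite_words fin) auto
  also have "\<dots> = m ^ n * measure \<nu> ?B"
    using invariant_words[of ?B n] m_pos by (simp add: field_simps)
  finally show ?thesis .
qed

lemma measure_ball_le:
  "measure \<nu> (ball z \<rho>) \<le> real (card {u \<in> words I n. \<bar>off u - z\<bar> \<le> \<rho> + 2 * \<beta> ^ n}) / m ^ n"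
proof -
  let ?U = "{u \<in> words I n. \<bar>off u - z\<bar> \<le> \<rho> + 2 * \<beta> ^ n}"
  let ?f = "\<lambda>u. measure \<nu> ((\<lambda>x. \<beta> ^ n * x + off u) -` ball z \<rho>)"
  have bn: "0 < \<beta> ^ n" using parameter_bounds(1) by simp
  have space: "space \<nu> = UNIV" using sets_eq_imp_space_eq[OF sets_nu] by simp
  have zero: "?f u = 0" if "u \<in> words I n - ?U" for u
  proof -
    have "(\<lambda>x. \<beta> ^ n * x + off u) -` ball z \<rho> \<subseteq> space \<nu> - {-1..2}"
    proof
      fix x assume x: "x \<in> (\<lambda>x. \<beta> ^ n * x + off u) -` ball z \<rho>"
      have "x \<notin> {-1..2}"
      proof
        assume "x \<in> {-1..2}"
        then have "\<beta> ^ n * (-1) \<le> \<beta> ^ n * x" "\<beta> ^ n * x \<le> \<beta> ^ n * 2"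
          using bn mult_left_mono[of "-1" x "\<beta> ^ n"] by auto
        moreover have "\<bar>z - (\<beta> ^ n * x + off u)\<bar> < \<rho>" using x by (simp add: dist_real_def)
        moreover have "\<rho> + 2 * \<beta> ^ n < \<bar>off u - z\<bar>" using that by auto
        ultimately show False by linarith
      qed
      then show "x \<in> space \<nu> - {-1..2}" using space by simp
    qed
    then have "?f u \<le> measure \<nu> (space \<nu> - {-1..2})"
      by (intro finite_measure_mono) (auto simp: sets_nu space)
    then show ?thesis using prob_compl[of "{-1..2}"] measure_core measure_nonneg[of \<nu>]
      by (simp add: sets_nu order_antisym)
  qed
  have "(\<Sum>u\<in>words I n. ?f u) = (\<Sum>u\<in>?U. ?f u)"
    by (rule sum.mono_neutral_right) (use zero fin in \<open>auto simp: finite_words\<close>)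
  also have "\<dots> \<le> (\<Sum>u\<in>?U. 1)" by (intro sum_mono prob_le_1)
  finally have "(\<Sum>u\<in>words I n. ?f u) \<le> real (card ?U)" by simp
  then show ?thesis
    using invariant_words[of "ball z \<rho>" n] m_pos by (simp add: divide_right_mono)
qed

lemma card_offsets_frostman:
  assumes "frostman_exponent \<nu> t"
  obtains C where "0 < C" "\<And>n z \<rho>. 0 < \<rho> \<Longrightarrow>
    real (card {u \<in> words I n. \<bar>off u - z\<bar> \<le> \<rho>}) \<le> C * m ^ n * (max \<rho> (\<beta> ^ n)) powr t"
proof -
  obtain C where t: "0 \<le> t" and C: "0 < C" "\<And>r z. 0 < r \<Longrightarrow> r < 1 \<Longrightarrow> measure \<nu> (ball z r) \<le> C * r powr t"
    using assms unfolding frostman_exponent_def by auto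
  have all: "measure \<nu> (ball z r) \<le> (C + 1) * r powr t" if "0 < r" for z r
  proof (cases "r < 1")
    case True
    then show ?thesis using C(2)[OF that True, of z] by (simp add: distrib_right add_increasing2)
  next
    case False
    then have "1 * 1 \<le> (C + 1) * r powr t" using C(1) t by (intro mult_mono ge_one_powr_ge_zero) auto
    then show ?thesis using prob_le_1[of "ball z r"] by linarith
  qed
  have "real (card {u \<in> words I n. \<bar>off u - z\<bar> \<le> \<rho>}) \<le> ((C + 1) * 4 powr t) * m ^ n * (max \<rho> (\<beta> ^ n)) powr t"
    if r: "0 < \<rho>" for n z \<rho>
  proof -
    have bn: "0 < \<beta> ^ n" using parameter_bounds(1) by simp
    have "measure \<nu> (ball z (\<rho> + 3 * \<beta> ^ n)) \<le> (C + 1) * (\<rho> + 3 * \<beta> ^ n) powr t"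
      using r bn by (intro all) auto
    also have "\<dots> \<le> (C + 1) * (4 * max \<rho> (\<beta> ^ n)) powr t"
      using r bn C(1) t by (intro mult_left_mono powr_mono2) auto
    also have "\<dots> = ((C + 1) * 4 powr t) * (max \<rho> (\<beta> ^ n)) powr t" using r by (simp add: powr_mult)
    finally have "m ^ n * measure \<nu> (ball z (\<rho> + 3 * \<beta> ^ n)) \<le>
        m ^ n * (((C + 1) * 4 powr t) * (max \<rho> (\<beta> ^ n)) powr t)"
      using m_pos by (intro mult_left_mono) auto
    then show ?thesis using card_offsets_le[of n z \<rho>] by (simp add: mult_ac)
  qed
  then show thesis using that[of "(C + 1) * 4 powr t"] C(1) by simp
qed

text \<open>A single word already has mass at least \<open>1 / m ^ n\<close> near its cylinder. This makes \<open>\<kappa> t\<close>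
  below nonnegative.\<close>
lemma frostman_exponent_growth:
  assumes "frostman_exponent \<nu> t"
  shows "1 \<le> m * \<beta> powr t"
proof -
  obtain C where C: "0 < C" "\<And>n z \<rho>. 0 < \<rho> \<Longrightarrow>
    real (card {u \<in> words I n. \<bar>off u - z\<bar> \<le> \<rho>}) \<le> C * m ^ n * (max \<rho> (\<beta> ^ n)) powr t"
    using card_offsets_frostman[OF assms] by blast
  obtain i where i: "i \<in> I" using ne by blast
  show ?thesis
  proof (rule one_le_ratio)
    fix n
    have bn: "0 < \<beta> ^ n" using parameter_bounds(1) by simp
    let ?w = "replicate n i"
    have "?w \<in> {u \<in> words I n. \<bar>off u - off ?w\<bar> \<le> \<beta> ^ n}"
      using i bn by (auto simp: words_def)
    then have "card {?w} \<le> card {u \<in> words I n. \<bar>off u - off ?w\<bar> \<le> \<beta> ^ n}"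
      using finite_words[OF fin] by (intro card_mono) auto
    then have "1 \<le> real (card {u \<in> words I n. \<bar>off u - off ?w\<bar> \<le> \<beta> ^ n})" by simp
    also have "\<dots> \<le> C * m ^ n * (max (\<beta> ^ n) (\<beta> ^ n)) powr t" using C(2)[OF bn] .
    also have "\<dots> = C * (m * \<beta> powr t) ^ n"
      using parameter_bounds(1) by (simp add: powr_power_swap power_mult_distrib)
    finally show "1 \<le> C * (m * \<beta> powr t) ^ n" .
  qed (use m_pos in simp)
qed

lemma fst_K_unit: "fst ` K \<subseteq> {0..1}" using K_unit by auto

text \<open>All \<open>m ^ n\<close> cylinders meet \<open>X\<close>, and a ball of radius \<open>\<beta> ^ n\<close> sees at most \<open>C m ^ n (\<beta> ^ n) powr t\<close> of
  them, so a cover of \<open>X\<close> at that scale has at least about \<open>(\<beta> ^ n) powr (- t)\<close> members.\<close>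
lemma frostman_le_assouad:
  assumes "frostman_exponent \<nu> t" "assouad_exponent (fst ` K) e"
  shows "t \<le> e"
proof -
  obtain C where C: "0 < C" "\<And>n z \<rho>. 0 < \<rho> \<Longrightarrow>
    real (card {u \<in> words I n. \<bar>off u - z\<bar> \<le> \<rho>}) \<le> C * m ^ n * (max \<rho> (\<beta> ^ n)) powr t"
    using card_offsets_frostman[OF assms(1)] by blast
  obtain D where D: "0 < D" "\<And>r R z. 0 < r \<Longrightarrow> 0 < R \<Longrightarrow>
       real (covering_number r (fst ` K \<inter> ball z R)) \<le> D * (max 1 (min R 1 / r)) powr e"
    using assouad_exponent_uniform[OF assms(2) fst_K_unit] by blast
  obtain q where q: "q \<in> K" using K_ne by blast
  have "1 \<le> \<beta> powr (t - e)"
  proof (rule one_le_ratio)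
    fix n
    have bn: "0 < \<beta> ^ n" "\<beta> ^ n \<le> 1" using parameter_bounds(1) beta_1 by (auto simp: power_le_one)
    have whole: "fst ` K \<inter> ball (1/2) 1 = fst ` K"
      using K_unit by (auto simp: dist_real_def abs_if) (smt (verit) field_sum_of_halves)+
    have bd: "bounded (fst ` K)" using K_compact by (simp add: bounded_fst compact_imp_bounded)
    obtain Y where Y: "finite Y" "card Y = covering_number (\<beta> ^ n) (fst ` K)"
      "fst ` K \<subseteq> (\<Union>y\<in>Y. ball y (\<beta> ^ n))"
      using covering_number_witness[OF bd bn(1)] by blast
    have "words I n \<subseteq> (\<Union>y\<in>Y. {u \<in> words I n. \<bar>off u - (y - \<beta> ^ n * fst q)\<bar> \<le> \<beta> ^ n})"
    proof
      fix u assume u: "u \<in> words I n"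
      then have "fst (T u q) \<in> fst ` K" using T_in_K q by blast
      then obtain y where "y \<in> Y" "dist y (fst (T u q)) < \<beta> ^ n" using Y(3) by auto
      then show "u \<in> (\<Union>y\<in>Y. {u \<in> words I n. \<bar>off u - (y - \<beta> ^ n * fst q)\<bar> \<le> \<beta> ^ n})"
        using u by (auto simp: T_def words_def dist_real_def intro!: bexI[of _ y])
    qed
    then have "card (words I n) \<le> card (\<Union>y\<in>Y. {u \<in> words I n. \<bar>off u - (y - \<beta> ^ n * fst q)\<bar> \<le> \<beta> ^ n})"
      using Y(1) finite_words[OF fin] by (intro card_mono) auto
    also have "\<dots> \<le> (\<Sum>y\<in>Y. card {u \<in> words I n. \<bar>off u - (y - \<beta> ^ n * fst q)\<bar> \<le> \<beta> ^ n})"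
      by (rule card_UN_le[OF Y(1)])
    finally have "m ^ n \<le> (\<Sum>y\<in>Y. real (card {u \<in> words I n. \<bar>off u - (y - \<beta> ^ n * fst q)\<bar> \<le> \<beta> ^ n}))"
      unfolding card_words[OF fin] by (simp flip: of_nat_power of_nat_sum)
    also have "\<dots> \<le> (\<Sum>y\<in>Y. C * m ^ n * (max (\<beta> ^ n) (\<beta> ^ n)) powr t)"
      by (intro sum_mono C(2) bn)
    also have "\<dots> = (C * (\<beta> ^ n) powr t * real (card Y)) * m ^ n" by (simp add: mult_ac)
    finally have "1 \<le> C * (\<beta> ^ n) powr t * real (card Y)" using m_pos by simp
    also have "\<dots> \<le> C * (\<beta> ^ n) powr t * (D * (1 / \<beta> ^ n) powr e)"
    proof (intro mult_left_mono)
      show "real (card Y) \<le> D * (1 / \<beta> ^ n) powr e"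
        using D(2)[OF bn(1), of 1 "1/2"] bn unfolding whole Y(2) by simp
    qed (use C(1) in auto)
    also have "\<dots> = (C * D) * (\<beta> powr (t - e)) ^ n"
    proof -
      have "(\<beta> ^ n) powr t * (1 / \<beta> ^ n) powr e = (\<beta> ^ n) powr (t - e)"
        using bn by (simp add: powr_diff powr_divide)
      then show ?thesis using parameter_bounds(1) by (simp add: powr_power_swap mult_ac)
    qed
    finally show "1 \<le> (C * D) * (\<beta> powr (t - e)) ^ n" .
  qed simp
  then show ?thesis using parameter_bounds(1) beta_1 powr01_less_one[of \<beta> "t - e"] by linarith
qed

end

section \<open>The upper bound\<close>

lemma geometric_level:
  fixes g x :: real
  assumes "0 < g" "g < 1" "0 < x" "x \<le> 1"
  obtains n where "g ^ Suc n < x" "x \<le> g ^ n"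
proof -
  obtain k where k: "g ^ k < x" using real_arch_pow_inv[OF assms(3,2)] by blast
  define j where "j = (LEAST k. g ^ k < x)"
  have j: "g ^ j < x" unfolding j_def by (rule LeastI[of _ k]) (rule k)
  then have "j \<noteq> 0" using assms(4) by (intro notI) simp
  then obtain n where n: "j = Suc n" by (cases j) auto
  have "\<not> g ^ n < x" using not_less_Least[of n "\<lambda>k. g ^ k < x"] n unfolding j_def by simp
  then show thesis using that[of n] j n by simp
qed

context carpet
begin

lemma bounded_K: "bounded S" if "S \<subseteq> K"
  using that K_compact compact_imp_bounded bounded_subset by blast

lemma bounded_fst_K: "bounded S" if "S \<subseteq> fst ` K"
  using that bounded_K[OF order_refl] bounded_fst bounded_subset by blast

text \<open>At a resolution coarser than its height a cylinder is a flat copy of \<open>X\<close>, and a window of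
  radius \<open>R\<close> in it comes from a window of radius \<open>R / \<beta> ^ k\<close> in \<open>X\<close>.\<close>
lemma covering_number_piece:
  assumes w: "w \<in> words I k" and r: "\<alpha> ^ k \<le> r"
  shows "covering_number r (T w ` K \<inter> ball p R) \<le>
    covering_number (r / 2 / \<beta> ^ k)
      (fst ` K \<inter> ball ((fst p - word_offset \<beta> b w) / \<beta> ^ k) (R / \<beta> ^ k))"
proof -
  have len: "length w = k" using w by (simp add: words_def)
  have ak: "0 < \<alpha> ^ k" and bk: "0 < \<beta> ^ k" using alpha_pos parameter_bounds(1) by auto
  have r0: "0 < r" using ak r by linarith
  let ?E = "T w ` K \<inter> ball p R"
  let ?F = "fst ` K \<inter> ball ((fst p - word_offset \<beta> b w) / \<beta> ^ k) (R / \<beta> ^ k)"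
  have sub: "fst ` ?E \<subseteq> (\<lambda>x. \<beta> ^ k * x + word_offset \<beta> b w) ` ?F"
  proof clarify
    fix x1 y1 x y assume *: "(x1, y1) = T w (x, y)" "(x, y) \<in> K" "(x1, y1) \<in> ball p R"
    have "\<bar>fst p - x1\<bar> < R" using *(3) dist_fst_le[of p "(x1, y1)"] by (simp add: dist_real_def)
    moreover have x1: "x1 = \<beta> ^ k * x + word_offset \<beta> b w" using *(1) len by (simp add: T_def)
    moreover have "(fst p - word_offset \<beta> b w) / \<beta> ^ k - x = (fst p - x1) / \<beta> ^ k"
      using parameter_bounds(1) unfolding x1 by (simp add: field_simps)
    ultimately have "x \<in> ?F"
      using bk *(2) by (auto simp: dist_real_def divide_strict_right_mono image_iff intro!: bexI[of _ "(x, y)"])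
    then show "fst (x1, y1) \<in> (\<lambda>x. \<beta> ^ k * x + word_offset \<beta> b w) ` ?F"
      using x1 by (metis (no_types, lifting) fst_conv image_eqI)
  qed
  have bE: "bounded ?E" using T_in_K[OF w] by (intro bounded_K) auto
  have bF: "bounded ?F" by (intro bounded_fst_K) auto
  have "covering_number r ?E \<le> covering_number (r / 2) (fst ` ?E)"
  proof (rule covering_number_strip_le[OF bE r0])
    fix q assume "q \<in> ?E"
    then obtain q' where "q' \<in> K" "q = T w q'" by blast
    moreover from this have "\<alpha> ^ k * snd q' \<le> r"
      using K_unit[of q'] ak r mult_left_le[of "snd q'" "\<alpha> ^ k"] by linarith
    ultimately show "word_offset \<alpha> a w \<le> snd q \<and> snd q \<le> word_offset \<alpha> a w + r"
      using K_unit[of q'] ak len by (simp add: T_def)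
  qed
  also have "\<dots> \<le> covering_number (r / 2) ((\<lambda>x. \<beta> ^ k * x + word_offset \<beta> b w) ` ?F)"
    using r0 bounded_translation[OF bounded_scaling[OF bF, of "\<beta> ^ k"], of "word_offset \<beta> b w"]
    by (intro covering_number_mono sub) (simp_all add: image_image add.commute)
  also have "\<dots> = covering_number (r / 2 / \<beta> ^ k) ?F"
    using covering_number_affine_image[OF bF, of "r / 2 / \<beta> ^ k" "\<beta> ^ k" "word_offset \<beta> b w"] r0 bk parameter_bounds(1)
    by simp
  finally show ?thesis .
qed

end

context carpet_measure
begin

definition \<kappa> :: "real \<Rightarrow> real" where "\<kappa> t = ln (m * \<beta> powr t) / ln (1 / \<alpha>)"

lemma kappa: "(1 / \<alpha>) powr \<kappa> t = m * \<beta> powr t"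
  using alpha_pos parameter_bounds m_pos by (simp add: \<kappa>_def powr_def field_simps)

lemma kappa_affine: "\<kappa> t = ln m / ln (1 / \<alpha>) - t * (ln (1 / \<beta>) / ln (1 / \<alpha>))"
  using parameter_bounds m_pos by (simp add: \<kappa>_def ln_mult ln_powr ln_div add_divide_distrib)

text \<open>Choose levels with \<open>\<alpha> ^ n\<close> comparable to \<open>R\<close> and \<open>\<alpha> ^ (n + l)\<close> comparable to \<open>r\<close>. Boundedly many words
  \<open>w\<close> of length \<open>n\<close> meet the ball, the Frostman exponent bounds the number of continuations \<open>u\<close> of length
  \<open>l\<close> that reach it, and each cylinder of \<open>w @ u\<close> is a flat copy of \<open>X\<close>.\<close>
lemma assouad_exponent_K:
  assumes t: "frostman_exponent \<nu> t" and e: "assouad_exponent (fst ` K) e"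
  shows "assouad_exponent K (e + \<kappa> t)"
proof -
  have te: "t \<le> e" using frostman_le_assouad[OF t e] .
  have t0: "0 \<le> t" using t by (simp add: frostman_exponent_def)
  have k0: "0 \<le> \<kappa> t"
    using frostman_exponent_growth[OF t] alpha_pos parameter_bounds(2) by (simp add: \<kappa>_def)
  obtain C where C: "0 < C" "\<And>n z \<rho>. 0 < \<rho> \<Longrightarrow>
    real (card {u \<in> words I n. \<bar>off u - z\<bar> \<le> \<rho>}) \<le> C * m ^ n * (max \<rho> (\<beta> ^ n)) powr t"
    using card_offsets_frostman[OF t] by blast
  obtain D where D: "0 < D" "\<And>r R z. 0 < r \<Longrightarrow> 0 < R \<Longrightarrow>
       real (covering_number r (fst ` K \<inter> ball z R)) \<le> D * (max 1 (min R 1 / r)) powr e"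
    using assouad_exponent_uniform[OF e fst_K_unit] by blast
  define Q where "Q = 9 * (C * 2 powr t) * (D * (2 / \<alpha>) powr e) * (1 / \<alpha>\<^sup>2) powr \<kappa> t"
  have "real (covering_number r (K \<inter> ball p R)) \<le> Q * (R / r) powr (e + \<kappa> t)"
    if rR: "0 < r" "r \<le> R" "R \<le> 1" for r R p
  proof -
    have R0: "0 < R" and r1: "r \<le> 1" using rR by auto
    obtain n where n: "\<alpha> ^ Suc n < R" "R \<le> \<alpha> ^ n"
      using geometric_level[OF alpha_pos parameter_bounds(2) R0 rR(3)] by blast
    obtain n1 where n1: "\<alpha> ^ Suc n1 < r" "r \<le> \<alpha> ^ n1"
      using geometric_level[OF alpha_pos parameter_bounds(2) rR(1) r1] by blast
    have "\<alpha> ^ Suc n1 < \<alpha> ^ n" using n1 n rR by linarith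
    then have "n < Suc n1" using power_decreasing[of "Suc n1" n \<alpha>] alpha_pos parameter_bounds(2) by fastforce
    then obtain l where l: "Suc n1 = n + l" by (metis less_imp_add_positive)
    define k where "k = n + l"
    have ab: "\<alpha> ^ j \<le> \<beta> ^ j" for j using alpha_pos alpha_beta by (intro power_mono) auto
    have pos: "0 < \<alpha> ^ j" "0 < \<beta> ^ j" for j using alpha_pos parameter_bounds(1) by auto
    have ak: "\<alpha> ^ k < r" "\<alpha> * r \<le> \<alpha> ^ k"
      using n1 alpha_pos l[symmetric] unfolding k_def by auto
    \<comment> \<open>\<open>M\<close> is the horizontal extent of one cylinder inside the ball, and \<open>\<rho>\<close> is how far, seen from
      \<open>w\<close>, the offset of \<open>u\<close> may be from the centre of the ball.\<close>
    define M where "M = min R (\<beta> ^ k)"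
    define \<rho> where "\<rho> = R / \<beta> ^ n + \<beta> ^ l"
    have rho0: "0 < \<rho>" unfolding \<rho>_def using R0 pos by (simp add: add_pos_pos)
    define W where "W = {w \<in> words I n. T w ` ({0..1} \<times> {0..1}) \<inter> ball p R \<noteq> {}}"
    define U where "U w = {u \<in> words I l. \<bar>off u - (fst p - off w) / \<beta> ^ n\<bar> \<le> \<rho>}" for w
    have finW: "finite W" and finU: "finite (U w)" for w
      unfolding W_def U_def using finite_words[OF fin] by auto
    have cover: "K \<inter> ball p R \<subseteq> (\<Union>w\<in>W. \<Union>u\<in>U w. T (w @ u) ` K \<inter> ball p R)"
    proof
      fix q assume q: "q \<in> K \<inter> ball p R"
      then obtain w q1 where w: "w \<in> words I n" "q1 \<in> K" "q = T w q1" using K_words[of n] by blast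
      obtain u q2 where u: "u \<in> words I l" "q2 \<in> K" "q1 = T u q2" using K_words[of l] w(2) by blast
      have "q1 \<in> {0..1} \<times> {0..1}" using K_unit[OF w(2)] by (simp add: mem_Times_iff)
      then have "w \<in> W" using w q unfolding W_def by blast
      moreover have "u \<in> U w"
      proof -
        have "fst q = \<beta> ^ n * (\<beta> ^ l * fst q2 + off u) + off w"
          using w u by (simp add: T_def words_def)
        then have "(fst p - off w) / \<beta> ^ n - (\<beta> ^ l * fst q2 + off u) = (fst p - fst q) / \<beta> ^ n"
          using parameter_bounds(1) by (simp add: field_simps)
        moreover have "\<bar>fst p - fst q\<bar> < R" using q dist_fst_le[of p q] by (simp add: dist_real_def)
        ultimately have "\<bar>(fst p - off w) / \<beta> ^ n - (\<beta> ^ l * fst q2 + off u)\<bar> < R / \<beta> ^ n"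
          using pos(2)[of n] by (simp add: divide_strict_right_mono)
        moreover have "0 \<le> \<beta> ^ l * fst q2" "\<beta> ^ l * fst q2 \<le> \<beta> ^ l"
          using K_unit[OF u(2)] pos(2)[of l] by (auto simp: mult_left_le)
        ultimately have "\<bar>off u - (fst p - off w) / \<beta> ^ n\<bar> \<le> \<rho>" unfolding \<rho>_def by linarith
        then show ?thesis using u(1) by (simp add: U_def)
      qed
      moreover have "q \<in> T (w @ u) ` K" using w u by (simp add: T_append)
      ultimately show "q \<in> (\<Union>w\<in>W. \<Union>u\<in>U w. T (w @ u) ` K \<inter> ball p R)" using q by blast
    qed
    have piece: "real (covering_number r (T (w @ u) ` K \<inter> ball p R)) \<le> D * (2 / \<alpha>) powr e * (M / r) powr e"
      if "w \<in> W" "u \<in> U w" for w u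
    proof -
      have wu: "w @ u \<in> words I k"
        using that words_append unfolding W_def U_def k_def by blast
      let ?z = "(fst p - off (w @ u)) / \<beta> ^ k"
      have "real (covering_number r (T (w @ u) ` K \<inter> ball p R)) \<le>
          real (covering_number (r / 2 / \<beta> ^ k) (fst ` K \<inter> ball ?z (R / \<beta> ^ k)))"
        using covering_number_piece[OF wu, of r p R] ak by simp
      also have "\<dots> \<le> D * (max 1 (min (R / \<beta> ^ k) 1 / (r / 2 / \<beta> ^ k))) powr e"
        using rR R0 pos by (intro D(2)) auto
      also have "min (R / \<beta> ^ k) 1 / (r / 2 / \<beta> ^ k) = 2 * (M / r)"
        using pos(2)[of k] parameter_bounds(1) rR by (auto simp: M_def min_def field_simps)
      also have "D * (max 1 (2 * (M / r))) powr e \<le> D * ((2 / \<alpha>) * (M / r)) powr e"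
      proof (intro mult_left_mono powr_mono2)
        have "\<alpha> * r \<le> M" unfolding M_def
          using ak(2) ab[of k] rR alpha_pos parameter_bounds(2) mult_left_le_one_le[of r \<alpha>] by linarith
        then have am: "\<alpha> \<le> M / r" using rR by (simp add: field_simps)
        then have "(1 / \<alpha>) * \<alpha> \<le> (1 / \<alpha>) * (M / r)" using alpha_pos by (intro mult_left_mono) auto
        then have "1 \<le> (1 / \<alpha>) * (M / r)" using alpha_pos by simp
        moreover have "(1 / \<alpha>) * (M / r) \<le> (2 / \<alpha>) * (M / r)"
          using am alpha_pos by (intro mult_right_mono) (auto simp: field_simps)
        moreover have "2 * (M / r) \<le> (2 / \<alpha>) * (M / r)"
          using am alpha_pos parameter_bounds(2) by (intro mult_right_mono) (auto simp: field_simps)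
        ultimately show "max 1 (2 * (M / r)) \<le> (2 / \<alpha>) * (M / r)"
          by linarith
      qed (use e D in \<open>auto simp: assouad_exponent_def\<close>)
      also have "\<dots> = D * (2 / \<alpha>) powr e * (M / r) powr e"
        using alpha_pos rR R0 pos by (subst powr_mult) (auto simp: M_def)
      finally show ?thesis .
    qed
    have cU: "real (card (U w)) \<le> (C * 2 powr t) * m ^ l * (max (R / \<beta> ^ n) (\<beta> ^ l)) powr t" for w
    proof -
      have "real (card (U w)) \<le> C * m ^ l * (max \<rho> (\<beta> ^ l)) powr t"
        unfolding U_def by (rule C(2)[OF rho0])
      also have "\<dots> \<le> C * m ^ l * (2 * max (R / \<beta> ^ n) (\<beta> ^ l)) powr t"
      proof (intro mult_left_mono powr_mono2)
        show "max \<rho> (\<beta> ^ l) \<le> 2 * max (R / \<beta> ^ n) (\<beta> ^ l)"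
          unfolding \<rho>_def using pos(2)[of l] by linarith
      qed (use t0 C m_pos pos(2)[of l] in auto)
      also have "\<dots> = (C * 2 powr t) * m ^ l * (max (R / \<beta> ^ n) (\<beta> ^ l)) powr t"
        using pos(2)[of l] by (subst powr_mult) auto
      finally show ?thesis .
    qed
    \<comment> \<open>If the window is wider than a cylinder of level \<open>n + l\<close>, more words are counted, but each cylinder
      fills only a part \<open>\<beta> ^ k\<close> of the window; since \<open>t \<le> e\<close>, the second effect outweighs the first.\<close>
    have trade: "(max (R / \<beta> ^ n) (\<beta> ^ l)) powr t * (M / r) powr e \<le> (\<beta> ^ l) powr t * (R / r) powr e"
    proof (cases "R \<le> \<beta> ^ k")
      case True
      then have "R / \<beta> ^ n \<le> \<beta> ^ l" using pos(2)[of n] unfolding k_def power_add by (simp add: field_simps)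
      then show ?thesis using True by (simp add: M_def)
    next
      case False
      define q where "q = R / \<beta> ^ k"
      have q: "1 \<le> q" using False pos(2)[of k] by (simp add: q_def)
      have eq: "R / \<beta> ^ n = \<beta> ^ l * q" "M / r = (R / r) / q"
        using False parameter_bounds(1) R0 by (auto simp: q_def M_def k_def power_add field_simps)
      have "\<beta> ^ l \<le> \<beta> ^ l * q" using q pos(2)[of l] by simp
      then have "(max (R / \<beta> ^ n) (\<beta> ^ l)) powr t * (M / r) powr e =
          ((\<beta> ^ l) powr t * (R / r) powr e) * q powr (t - e)"
        unfolding eq using q rR R0 pos(2)[of l]
        by (simp add: max_absorb1 powr_mult powr_divide powr_diff)
      also have "\<dots> \<le> ((\<beta> ^ l) powr t * (R / r) powr e) * 1"
      proof (rule mult_left_mono)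
        show "q powr (t - e) \<le> 1" using q te powr_mono[of "t - e" 0 q] by simp
      qed simp
      finally show ?thesis by simp
    qed
    have growth: "m ^ l * (\<beta> ^ l) powr t \<le> (1 / \<alpha>\<^sup>2) powr \<kappa> t * (R / r) powr \<kappa> t"
    proof -
      have "m ^ l * (\<beta> ^ l) powr t = ((1 / \<alpha>) powr \<kappa> t) ^ l"
        using parameter_bounds(1) by (simp add: kappa powr_power_swap power_mult_distrib)
      also have "\<dots> = ((1 / \<alpha>) ^ l) powr \<kappa> t" using alpha_pos by (simp add: powr_power_swap)
      also have "\<dots> \<le> ((1 / \<alpha>\<^sup>2) * (R / r)) powr \<kappa> t"
      proof (rule powr_mono2)
        have "\<alpha> ^ k = \<alpha> ^ n * \<alpha> ^ l" by (simp add: k_def power_add)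
        have "\<alpha> ^ n * \<alpha> \<le> R" using n(1) by (simp add: mult.commute)
        have "(\<alpha> * r) * (\<alpha> ^ n * \<alpha>) \<le> (\<alpha> ^ n * \<alpha> ^ l) * R"
          by (rule mult_mono)
            (use ak(2) \<open>\<alpha> ^ k = \<alpha> ^ n * \<alpha> ^ l\<close> \<open>\<alpha> ^ n * \<alpha> \<le> R\<close> alpha_pos pos(1) in auto)
        then have "\<alpha> ^ n * (\<alpha> * r * \<alpha>) \<le> \<alpha> ^ n * (\<alpha> ^ l * R)" by (simp add: mult_ac)
        then have "\<alpha> * r * \<alpha> \<le> \<alpha> ^ l * R" using pos(1)[of n] by simp
        then show "(1 / \<alpha>) ^ l \<le> (1 / \<alpha>\<^sup>2) * (R / r)"
          using alpha_pos rR by (simp add: field_simps power2_eq_square)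
      qed (use k0 alpha_pos in auto)
      also have "\<dots> = (1 / \<alpha>\<^sup>2) powr \<kappa> t * (R / r) powr \<kappa> t"
        using rR R0 by (subst powr_mult) auto
      finally show ?thesis .
    qed
    have bE: "bounded (T w ` K \<inter> ball p R)" for w by (rule bounded_Int) simp
    have "covering_number r (K \<inter> ball p R) \<le>
        covering_number r (\<Union>w\<in>W. \<Union>u\<in>U w. T (w @ u) ` K \<inter> ball p R)"
      using finW finU bE rR by (intro covering_number_mono cover) (auto simp: bounded_UN)
    also have "\<dots> \<le> (\<Sum>w\<in>W. covering_number r (\<Union>u\<in>U w. T (w @ u) ` K \<inter> ball p R))"
      using finW finU bE rR by (intro covering_number_UN_le) (auto simp: bounded_UN)
    also have "\<dots> \<le> (\<Sum>w\<in>W. \<Sum>u\<in>U w. covering_number r (T (w @ u) ` K \<inter> ball p R))"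
      using finU bE rR by (intro sum_mono covering_number_UN_le) auto
    finally have "real (covering_number r (K \<inter> ball p R)) \<le>
        (\<Sum>w\<in>W. \<Sum>u\<in>U w. real (covering_number r (T (w @ u) ` K \<inter> ball p R)))"
      by (simp flip: of_nat_sum)
    also have "\<dots> \<le> (\<Sum>w\<in>W. \<Sum>u\<in>U w. D * (2 / \<alpha>) powr e * (M / r) powr e)"
      by (intro sum_mono piece)
    also have "\<dots> = (\<Sum>w\<in>W. real (card (U w)) * (D * (2 / \<alpha>) powr e * (M / r) powr e))" by simp
    also have "\<dots> \<le> (\<Sum>w\<in>W. ((C * 2 powr t) * m ^ l * (max (R / \<beta> ^ n) (\<beta> ^ l)) powr t) *
        (D * (2 / \<alpha>) powr e * (M / r) powr e))"
      using D(1) by (intro sum_mono mult_right_mono cU) auto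
    also have "\<dots> = real (card W) * ((C * 2 powr t) * (D * (2 / \<alpha>) powr e) * m ^ l *
        ((max (R / \<beta> ^ n) (\<beta> ^ l)) powr t * (M / r) powr e))" by (simp add: mult_ac)
    also have "\<dots> \<le> 9 * ((C * 2 powr t) * (D * (2 / \<alpha>) powr e) * m ^ l *
        ((\<beta> ^ l) powr t * (R / r) powr e))"
    proof (rule mult_mono)
      show "real (card W) \<le> 9" using words_meeting_ball_le[OF n(2), of p] unfolding W_def by linarith
      show "(C * 2 powr t) * (D * (2 / \<alpha>) powr e) * m ^ l *
          ((max (R / \<beta> ^ n) (\<beta> ^ l)) powr t * (M / r) powr e) \<le>
        (C * 2 powr t) * (D * (2 / \<alpha>) powr e) * m ^ l * ((\<beta> ^ l) powr t * (R / r) powr e)"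
        using C D m_pos by (intro mult_left_mono trade) auto
    qed (use C D m_pos in auto)
    also have "\<dots> = (9 * (C * 2 powr t) * (D * (2 / \<alpha>) powr e) * (R / r) powr e) *
        (m ^ l * (\<beta> ^ l) powr t)" by (simp add: mult_ac)
    also have "\<dots> \<le> (9 * (C * 2 powr t) * (D * (2 / \<alpha>) powr e) * (R / r) powr e) *
        ((1 / \<alpha>\<^sup>2) powr \<kappa> t * (R / r) powr \<kappa> t)"
      using C D by (intro mult_left_mono growth) auto
    also have "\<dots> = Q * (R / r) powr (e + \<kappa> t)" by (simp add: Q_def powr_add mult_ac)
    finally show ?thesis .
  qed
  moreover have "0 < Q" using C D alpha_pos by (simp add: Q_def)
  moreover have "0 \<le> e + \<kappa> t" using e k0 by (simp add: assouad_exponent_def)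
  ultimately show ?thesis unfolding assouad_exponent_def by blast
qed

end

section \<open>The lower bound\<close>

text \<open>Used in contraposition: a sequence not bounded by a multiple of \<open>q ^ n\<close> grows by the factor
  \<open>q ^ l\<close> in \<open>l\<close> steps, starting from arbitrarily large \<open>n\<close>.\<close>
lemma growth_bound_from_ratio:
  fixes f :: "nat \<Rightarrow> real" and q :: real
  assumes q: "0 < q" and l: "0 < l" and step: "\<And>n. N \<le> n \<Longrightarrow> f (l + n) \<le> q ^ l * f n"
  obtains C where "0 < C" "\<And>n. f n \<le> C * q ^ n"
proof -
  define C where "C = 1 + (\<Sum>k<N + l. \<bar>f k\<bar> / q ^ k)"
  have "f n \<le> C * q ^ n" for n
  proof (induction n rule: less_induct)
    case (less n)
    show ?case
    proof (cases "n < N + l")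
      case True
      then have "\<bar>f n\<bar> / q ^ n \<le> (\<Sum>k<N + l. \<bar>f k\<bar> / q ^ k)"
        using q by (intro member_le_sum) auto
      then have "\<bar>f n\<bar> / q ^ n \<le> C" by (simp add: C_def)
      then show ?thesis using q by (simp add: field_simps)
    next
      case False
      define j where "j = n - l"
      have j: "n = l + j" "N \<le> j" "j < n" using False l by (auto simp: j_def)
      have "f n \<le> q ^ l * f j" using step[OF j(2)] j(1) by simp
      also have "\<dots> \<le> q ^ l * (C * q ^ j)" using less[OF j(3)] q by (intro mult_left_mono) auto
      finally show ?thesis unfolding j(1) by (simp add: power_add mult_ac)
    qed
  qed
  moreover have "0 < C" unfolding C_def using q by (intro add_pos_nonneg sum_nonneg) auto
  ultimately show thesis using that by blast
qed

context carpet_measure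
begin

text \<open>The copies of the closed ball of radius \<open>\<rho>\<close> about \<open>x\<close> under these words all contain \<open>z\<close>, so
  large cardinality means that many copies of one spot nearly coincide.\<close>
definition near :: "real \<Rightarrow> real \<Rightarrow> nat \<Rightarrow> real \<Rightarrow> 'a list set" where
  "near x \<rho> n z = {u \<in> words I n. \<bar>\<beta> ^ n * x + off u - z\<bar> \<le> \<beta> ^ n * \<rho>}"

definition peak :: "real \<Rightarrow> real \<Rightarrow> nat \<Rightarrow> nat" where
  "peak x \<rho> n = Max (range (\<lambda>z. card (near x \<rho> n z)))"

lemma finite_near: "finite (near x \<rho> n z)"
  unfolding near_def using finite_words[OF fin] by simp

lemma finite_range_near: "finite (range (\<lambda>z. card (near x \<rho> n z)))"
proof -
  have "card (near x \<rho> n z) \<le> card (words I n)" for z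
    unfolding near_def using finite_words[OF fin] by (intro card_mono) auto
  then have "range (\<lambda>z. card (near x \<rho> n z)) \<subseteq> {..card (words I n)}" by auto
  then show ?thesis by (rule finite_subset) simp
qed

lemma card_near_le_peak: "card (near x \<rho> n z) \<le> peak x \<rho> n"
  unfolding peak_def by (rule Max_ge[OF finite_range_near]) simp

lemma peak_attained: obtains z where "card (near x \<rho> n z) = peak x \<rho> n"
  using Max_in[OF finite_range_near[of x \<rho> n]] unfolding peak_def by (metis UNIV_not_empty image_is_empty rangeE)

lemma peak_pos:
  assumes "0 \<le> \<rho>"
  shows "0 < peak x \<rho> n"
proof -
  obtain i where "i \<in> I" using ne by blast
  then have "replicate n i \<in> near x \<rho> n (\<beta> ^ n * x + off (replicate n i))"
    using assms parameter_bounds(1) by (auto simp: near_def words_def)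
  then have "0 < card (near x \<rho> n (\<beta> ^ n * x + off (replicate n i)))"
    using finite_near card_gt_0_iff by blast
  then show ?thesis using card_near_le_peak order_less_le_trans by blast
qed

text \<open>An interval of length comparable to \<open>\<beta> ^ n\<close> is covered by a number of intervals of radius
  \<open>\<beta> ^ n * \<rho>\<close> that depends on \<open>\<rho>\<close> but not on \<open>n\<close>. So \<open>peak\<close>, for any fixed \<open>\<rho>\<close>, detects Frostman exponents as
  well as the mass of balls does.\<close>
lemma frostman_exponent_if_peak:
  assumes x: "0 \<le> x" "x \<le> 1" and rho: "0 < \<rho>" and t: "0 \<le> t"
    and C: "0 < C" "\<And>n. real (peak x \<rho> n) \<le> C * (m * \<beta> powr t) ^ n"
  shows "frostman_exponent \<nu> t"
proof -
  define N where "N = nat \<lceil>8 / \<rho>\<rceil>"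
  define D where "D = real (N + 1) * C * \<beta> powr (- t)"
  have "measure \<nu> (ball z r) \<le> D * r powr t" if r: "0 < r" "r < 1" for r z
  proof -
    obtain n where n: "\<beta> ^ Suc n < r" "r \<le> \<beta> ^ n"
      using geometric_level[OF parameter_bounds(1) beta_1 r(1)] r by auto
    have bn: "0 < \<beta> ^ n" using parameter_bounds(1) by simp
    let ?V = "{u \<in> words I n. \<bar>off u - z\<bar> \<le> r + 2 * \<beta> ^ n}"
    let ?z = "\<lambda>j. z - 4 * \<beta> ^ n + real j * (\<beta> ^ n * \<rho>)"
    have "?V \<subseteq> (\<Union>j\<in>{..N}. near x \<rho> n (?z j))"
    proof
      fix u assume u: "u \<in> ?V"
      define y where "y = \<beta> ^ n * x + off u - z + 4 * \<beta> ^ n"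
      have "0 \<le> \<beta> ^ n * x" "\<beta> ^ n * x \<le> \<beta> ^ n" using x bn by (auto simp: mult_left_le)
      moreover have "\<bar>off u - z\<bar> \<le> 3 * \<beta> ^ n" using u n(2) by auto
      ultimately have y: "0 \<le> y" "y \<le> 8 * \<beta> ^ n" unfolding y_def by linarith+
      define h where "h = \<beta> ^ n * \<rho>"
      have h: "0 < h" using bn rho by (simp add: h_def)
      define j where "j = nat \<lfloor>y / h\<rfloor>"
      have "0 \<le> y / h" using y h by simp
      then have j: "real j \<le> y / h" "y / h < real j + 1" unfolding j_def by linarith+
      have "y / h \<le> 8 * \<beta> ^ n / h" using y h by (intro divide_right_mono) auto
      also have "\<dots> = 8 / \<rho>" using parameter_bounds(1) by (simp add: h_def)
      finally have "j \<le> N" using j(1) unfolding N_def by linarith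
      moreover have "real j * h \<le> y" "y < real j * h + h" using j h by (simp_all add: field_simps)
      then have "\<bar>y - real j * h\<bar> \<le> h" by linarith
      then have "u \<in> near x \<rho> n (?z j)" using u unfolding near_def y_def h_def by (simp add: algebra_simps)
      ultimately show "u \<in> (\<Union>j\<in>{..N}. near x \<rho> n (?z j))" by blast
    qed
    then have "card ?V \<le> card (\<Union>j\<in>{..N}. near x \<rho> n (?z j))"
      using finite_near by (intro card_mono) auto
    also have "\<dots> \<le> (\<Sum>j\<in>{..N}. card (near x \<rho> n (?z j)))" by (rule card_UN_le) simp
    also have "\<dots> \<le> (\<Sum>j\<in>{..N}. peak x \<rho> n)" by (intro sum_mono card_near_le_peak)
    also have "\<dots> = (N + 1) * peak x \<rho> n" by simp
    finally have "real (card ?V) \<le> real (N + 1) * real (peak x \<rho> n)"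
      unfolding of_nat_mult[symmetric] by (rule of_nat_mono)
    also have "\<dots> \<le> real (N + 1) * (C * (m * \<beta> powr t) ^ n)" by (intro mult_left_mono C(2)) simp
    finally have V: "real (card ?V) \<le> real (N + 1) * C * (\<beta> ^ n) powr t * m ^ n"
      using parameter_bounds(1) by (simp add: power_mult_distrib powr_power_swap mult_ac)
    have "measure \<nu> (ball z r) \<le> real (card ?V) / m ^ n" by (rule measure_ball_le)
    also have "\<dots> \<le> (real (N + 1) * C * (\<beta> ^ n) powr t * m ^ n) / m ^ n"
      using V m_pos by (intro divide_right_mono) auto
    also have "\<dots> = real (N + 1) * C * (\<beta> ^ n) powr t" using m_pos by simp
    also have "\<dots> \<le> real (N + 1) * C * (r / \<beta>) powr t"
    proof (intro mult_left_mono powr_mono2)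
      show "\<beta> ^ n \<le> r / \<beta>" using n(1) parameter_bounds(1) by (simp add: field_simps)
    qed (use C(1) t bn in auto)
    also have "\<dots> = D * r powr t"
      using r parameter_bounds(1) by (simp add: D_def powr_divide powr_minus_divide)
    finally show ?thesis .
  qed
  moreover have "0 < D" using C(1) parameter_bounds(1) by (simp add: D_def)
  ultimately show ?thesis unfolding frostman_exponent_def using t by auto
qed

text \<open>At a point where the peak of level \<open>l + G\<close> is attained, the words with a given prefix of length \<open>l\<close> are,
  after rescaling by that prefix, near a point at level \<open>G\<close>, so they number at most the peak
  of level \<open>G\<close>. A level at which the ratio of the peaks is large therefore has many prefixes.\<close>
lemma many_prefixes:
  assumes x: "0 \<le> x" "x \<le> 1" and rho: "0 < \<rho>" and t: "0 \<le> t" "\<not> frostman_exponent \<nu> t"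
    and l: "0 < l"
  obtains G z U g where "N \<le> G" "U \<subseteq> words I l" "(m * \<beta> powr t) ^ l \<le> real (card U)"
    "\<And>u. u \<in> U \<Longrightarrow> g u \<in> words I G" "\<And>u. u \<in> U \<Longrightarrow> u @ g u \<in> near x \<rho> (l + G) z"
proof -
  let ?q = "m * \<beta> powr t"
  have q: "0 < ?q" using m_pos parameter_bounds(1) by simp
  have "\<exists>G\<ge>N. ?q ^ l * real (peak x \<rho> G) < real (peak x \<rho> (l + G))"
  proof (rule ccontr)
    assume "\<not> ?thesis"
    then have "\<And>G. N \<le> G \<Longrightarrow> real (peak x \<rho> (l + G)) \<le> ?q ^ l * real (peak x \<rho> G)"
      by (meson not_le)
    then obtain C where "0 < C" "\<And>n. real (peak x \<rho> n) \<le> C * ?q ^ n"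
      using growth_bound_from_ratio[OF q l, of N "\<lambda>n. real (peak x \<rho> n)"] by blast
    then show False using frostman_exponent_if_peak[OF x rho t(1)] t(2) by blast
  qed
  then obtain G where G: "N \<le> G" "?q ^ l * real (peak x \<rho> G) < real (peak x \<rho> (l + G))" by blast
  obtain z where z: "card (near x \<rho> (l + G) z) = peak x \<rho> (l + G)" using peak_attained by blast
  define U where "U = {u \<in> words I l. \<exists>v\<in>words I G. u @ v \<in> near x \<rho> (l + G) z}"
  have finU: "finite U" unfolding U_def using finite_words[OF fin] by simp
  have "near x \<rho> (l + G) z \<subseteq> (\<Union>u\<in>U. (\<lambda>v. u @ v) ` near x \<rho> G ((z - off u) / \<beta> ^ l))"
  proof
    fix w assume w: "w \<in> near x \<rho> (l + G) z"
    then obtain u v where uv: "w = u @ v" "u \<in> words I l" "v \<in> words I G"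
      by (auto simp: near_def words_add)
    have bl: "0 < \<beta> ^ l" using parameter_bounds(1) by simp
    have "\<beta> ^ (l + G) * x + off w - z = \<beta> ^ l * (\<beta> ^ G * x + off v - (z - off u) / \<beta> ^ l)"
      using uv parameter_bounds(1) by (simp add: word_offset_append words_def power_add field_simps)
    moreover have "\<bar>\<beta> ^ (l + G) * x + off w - z\<bar> \<le> \<beta> ^ (l + G) * \<rho>" using w by (simp add: near_def)
    ultimately have "\<beta> ^ l * \<bar>\<beta> ^ G * x + off v - (z - off u) / \<beta> ^ l\<bar> \<le> \<beta> ^ l * (\<beta> ^ G * \<rho>)"
      using bl by (simp add: abs_mult power_add mult.assoc)
    then have "v \<in> near x \<rho> G ((z - off u) / \<beta> ^ l)"
      using uv(3) bl by (simp only: mult_le_cancel_left_pos near_def mem_Collect_eq simp_thms)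
    moreover have "u \<in> U" using uv w by (auto simp: U_def)
    ultimately show "w \<in> (\<Union>u\<in>U. (\<lambda>v. u @ v) ` near x \<rho> G ((z - off u) / \<beta> ^ l))"
      using uv(1) by blast
  qed
  then have "peak x \<rho> (l + G) \<le> card (\<Union>u\<in>U. (\<lambda>v. u @ v) ` near x \<rho> G ((z - off u) / \<beta> ^ l))"
    unfolding z[symmetric] using finite_near finU by (intro card_mono) auto
  also have "\<dots> \<le> (\<Sum>u\<in>U. card ((\<lambda>v. u @ v) ` near x \<rho> G ((z - off u) / \<beta> ^ l)))"
    by (rule card_UN_le[OF finU])
  also have "\<dots> \<le> (\<Sum>u\<in>U. peak x \<rho> G)"
    by (intro sum_mono order_trans[OF card_image_le[OF finite_near] card_near_le_peak])
  also have "\<dots> = card U * peak x \<rho> G" by simp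
  finally have "real (peak x \<rho> (l + G)) \<le> real (card U) * real (peak x \<rho> G)"
    unfolding of_nat_mult[symmetric] by (rule of_nat_mono)
  then have "?q ^ l * real (peak x \<rho> G) \<le> real (card U) * real (peak x \<rho> G)" using G(2) by linarith
  then have "?q ^ l \<le> real (card U)" using peak_pos[of \<rho> x G] rho by simp
  moreover have "\<forall>u\<in>U. \<exists>v. v \<in> words I G \<and> u @ v \<in> near x \<rho> (l + G) z"
    unfolding U_def by blast
  then obtain g where "\<forall>u\<in>U. g u \<in> words I G \<and> u @ g u \<in> near x \<rho> (l + G) z"
    by (rule bchoice[THEN exE])
  moreover have "U \<subseteq> words I l" unfolding U_def by blast
  ultimately show thesis using that[of G U g z] G(1) by blast
qed

text \<open>The level \<open>n\<close> is chosen so that a cylinder of level \<open>n\<close> turns the width \<open>\<beta> ^ (l + G) * R0\<close>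
  of the common spot of many prefixes into a width comparable to its own height \<open>\<alpha> ^ n\<close>. The pieces
  \<open>E u\<close> of \<open>K\<close> lying over that spot are then in one ball of radius \<open>6 \<alpha> ^ n\<close>. They belong to
  cylinders of height \<open>\<alpha> ^ (n + l)\<close>, which is at least the resolution \<open>r\<close>, so a ball of the cover
  serves at most nine of them, and each piece is as hard to cover as the original spot of \<open>X\<close>.\<close>
lemma spot_bound:
  assumes x0: "x0 \<in> fst ` K" and r0: "0 < r0" "r0 \<le> R0" "R0 \<le> 1"
    and t: "0 \<le> t" "\<not> frostman_exponent \<nu> t"
    and C: "0 < C" "\<And>r R p. 0 < r \<Longrightarrow> r \<le> R \<Longrightarrow> R \<le> 1 \<Longrightarrow> p \<in> K \<Longrightarrow>
       real (covering_number r (K \<inter> ball p R)) \<le> C * (R / r) powr A"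
    and l: "0 < l" "\<alpha> * (r0 / R0) \<le> \<alpha> ^ l"
  shows "(m * \<beta> powr t) ^ l * real (covering_number r0 (fst ` K \<inter> ball x0 R0))
    \<le> 9 * C * (6 / \<alpha> * (R0 / r0)) powr A"
proof -
  have pos: "0 < \<alpha> ^ j" "0 < \<beta> ^ j" for j using alpha_pos parameter_bounds(1) by auto
  obtain q0 where q0: "q0 \<in> K" "x0 = fst q0" using x0 by blast
  have x0_unit: "0 \<le> x0" "x0 \<le> 1" using K_unit[OF q0(1)] q0(2) by auto
  have R0: "0 < R0" using r0 by simp
  define \<eta> where "\<eta> = r0 / R0"
  have eta: "0 < \<eta>" "\<eta> \<le> 1" "\<eta> * R0 = r0" using r0 R0 by (auto simp: \<eta>_def)
  define \<gamma> where "\<gamma> = \<alpha> / \<beta>"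
  have gam: "0 < \<gamma>" "\<gamma> < 1" "\<alpha> = \<gamma> * \<beta>" "\<alpha> < \<gamma>"
    using alpha_pos alpha_beta beta_1 parameter_bounds(1) by (auto simp: \<gamma>_def field_simps)
  \<comment> \<open>A large \<open>G\<close> forces a large \<open>n\<close>; this makes \<open>6 \<alpha> ^ n \<le> 1\<close>, an admissible radius.\<close>
  obtain n0 where n0: "\<alpha> ^ n0 < 1 / 6" using real_arch_pow_inv[of "1/6" \<alpha>] parameter_bounds(2) by auto
  obtain N where N: "\<beta> ^ N < \<gamma> ^ n0"
    using real_arch_pow_inv[of "\<gamma> ^ n0" \<beta>] beta_1 gam(1) by auto
  obtain G z U g where G: "N \<le> G" and U: "U \<subseteq> words I l" "(m * \<beta> powr t) ^ l \<le> real (card U)"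
    and g: "\<And>u. u \<in> U \<Longrightarrow> g u \<in> words I G" "\<And>u. u \<in> U \<Longrightarrow> u @ g u \<in> near x0 R0 (l + G) z"
    using many_prefixes[OF x0_unit R0 t l(1)] by metis
  define \<rho> where "\<rho> = \<beta> ^ (l + G) * R0"
  have rho0: "0 < \<rho>" using pos R0 by (simp add: \<rho>_def)
  have "\<beta> ^ (l + G) \<le> \<beta> ^ N" using G parameter_bounds(1) beta_1 by (intro power_decreasing) auto
  then have rho: "\<rho> \<le> \<beta> ^ N" unfolding \<rho>_def using r0(3) pos(2)[of "l + G"] mult_left_le[of R0 "\<beta> ^ (l + G)"]
    by linarith
  have rho1: "\<rho> \<le> 1" using rho power_le_one[of \<beta> N] parameter_bounds(1) beta_1 by linarith
  obtain n where n: "\<gamma> ^ Suc n < \<rho>" "\<rho> \<le> \<gamma> ^ n"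
    using geometric_level[OF gam(1,2) rho0 rho1] by blast
  have "n0 \<le> n"
  proof (rule ccontr)
    assume "\<not> n0 \<le> n"
    then have "\<gamma> ^ n0 \<le> \<gamma> ^ Suc n" using gam by (intro power_decreasing) auto
    then show False using n(1) rho N by linarith
  qed
  then have "\<alpha> ^ n \<le> \<alpha> ^ n0" using alpha_pos parameter_bounds(2) by (intro power_decreasing) auto
  then have an: "6 * \<alpha> ^ n \<le> 1" using n0 by linarith
  have gn: "\<beta> ^ n * \<gamma> ^ n = \<alpha> ^ n" using gam(3) by (simp add: power_mult_distrib mult.commute)
  have up: "\<beta> ^ n * \<rho> \<le> \<alpha> ^ n" using mult_left_mono[OF n(2), of "\<beta> ^ n"] pos(2)[of n] gn by simp
  have low: "\<alpha> ^ Suc n \<le> \<beta> ^ n * \<rho>"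
  proof -
    have "\<alpha> ^ Suc n \<le> \<gamma> * \<alpha> ^ n" using gam(4) pos(1)[of n] by simp
    also have "\<dots> = \<beta> ^ n * \<gamma> ^ Suc n" using gn by (simp add: mult_ac)
    also have "\<dots> \<le> \<beta> ^ n * \<rho>" using n(1) pos(2)[of n] by simp
    finally show ?thesis .
  qed
  define R where "R = 6 * \<alpha> ^ n"
  \<comment> \<open>One factor \<open>\<alpha>\<close> below \<open>\<eta> * \<alpha> ^ n\<close> so that \<open>r\<close> stays below both \<open>\<alpha> ^ (n + l)\<close> and the image
    of the radius \<open>r0\<close>.\<close>
  define r where "r = \<eta> * \<alpha> ^ Suc n"
  have r: "0 < r" "r \<le> R" "R \<le> 1" "r \<le> \<alpha> ^ (n + l)"
  proof -
    show "0 < r" using eta pos(1)[of "Suc n"] by (simp add: r_def)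
    have "\<alpha> * \<alpha> ^ n \<le> 1 * \<alpha> ^ n" using parameter_bounds(2) pos(1)[of n] by (intro mult_right_mono) auto
    then have "\<eta> * \<alpha> ^ Suc n \<le> 1 * \<alpha> ^ n" using eta pos(1)[of "Suc n"] by (intro mult_mono) auto
    then show "r \<le> R" unfolding r_def R_def using pos(1)[of n] by linarith
    show "R \<le> 1" using an by (simp add: R_def)
    have "\<alpha> ^ n * (\<alpha> * \<eta>) \<le> \<alpha> ^ n * \<alpha> ^ l"
      using l(2) pos(1)[of n] unfolding \<eta>_def by (intro mult_left_mono) auto
    then show "r \<le> \<alpha> ^ (n + l)" by (simp add: r_def power_add mult_ac)
  qed
  obtain i where i: "i \<in> I" using ne by blast
  define w where "w = replicate n i"
  have w: "w \<in> words I n" using i by (auto simp: w_def words_def)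
  define B where "B = K \<inter> {p. fst p \<in> ball x0 R0}"
  define E where "E u = T (w @ u @ g u) ` B" for u
  have word: "w @ u @ g u \<in> words I (n + (l + G))" if "u \<in> U" for u
    using that U(1) g(1) w by (meson words_append subsetD)
  have EK: "E u \<subseteq> K" if "u \<in> U" for u using T_in_K[OF word[OF that]] by (auto simp: E_def B_def)
  have box: "\<bar>fst q - (\<beta> ^ n * z + off w)\<bar> \<le> 2 * \<alpha> ^ n"
    "word_offset \<alpha> a w \<le> snd q" "snd q \<le> word_offset \<alpha> a w + \<alpha> ^ n" if u: "u \<in> U" and q: "q \<in> E u" for u q
  proof -
    obtain p where p: "p \<in> K" "\<bar>fst p - x0\<bar> < R0" "q = T (w @ u @ g u) p"
      using q by (auto simp: E_def B_def dist_real_def)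
    define v where "v = u @ g u"
    have v: "v \<in> near x0 R0 (l + G) z" "v \<in> words I (l + G)"
      using g(2)[OF u] by (auto simp: v_def near_def)
    have "\<bar>\<beta> ^ (l + G) * x0 + off v - z\<bar> \<le> \<rho>" using v(1) by (simp add: near_def \<rho>_def)
    moreover have "\<bar>\<beta> ^ (l + G) * (fst p - x0)\<bar> \<le> \<rho>"
      unfolding \<rho>_def abs_mult using p(2) pos(2)[of "l + G"] by simp
    then have "\<bar>\<beta> ^ (l + G) * fst p - \<beta> ^ (l + G) * x0\<bar> \<le> \<rho>" by (simp add: right_diff_distrib)
    ultimately have close: "\<bar>\<beta> ^ (l + G) * fst p + off v - z\<bar> \<le> 2 * \<rho>" by linarith
    have q: "q = T w (T v p)" using p(3) by (simp add: v_def T_append)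
    then have "fst q - (\<beta> ^ n * z + off w) = \<beta> ^ n * (\<beta> ^ (l + G) * fst p + off v - z)"
      using w v(2) by (simp add: T_def words_def algebra_simps)
    then have "\<bar>fst q - (\<beta> ^ n * z + off w)\<bar> = \<beta> ^ n * \<bar>\<beta> ^ (l + G) * fst p + off v - z\<bar>"
      using pos(2)[of n] by (simp add: abs_mult)
    also have "\<dots> \<le> \<beta> ^ n * (2 * \<rho>)" using close pos(2)[of n] by (intro mult_left_mono) auto
    finally show "\<bar>fst q - (\<beta> ^ n * z + off w)\<bar> \<le> 2 * \<alpha> ^ n" using up by linarith
    have "T v p \<in> K" using T_in_K[OF v(2) p(1)] .
    then have "0 \<le> \<alpha> ^ n * snd (T v p)" "\<alpha> ^ n * snd (T v p) \<le> \<alpha> ^ n"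
      using K_unit[of "T v p"] pos(1)[of n] by (auto simp: mult_left_le)
    moreover have "snd q = \<alpha> ^ n * snd (T v p) + word_offset \<alpha> a w"
      using q w by (simp add: T_def words_def)
    ultimately show "word_offset \<alpha> a w \<le> snd q" "snd q \<le> word_offset \<alpha> a w + \<alpha> ^ n" by linarith+
  qed
  have "0 < (m * \<beta> powr t) ^ l" using m_pos parameter_bounds(1) by simp
  then have "0 < real (card U)" using U(2) by linarith
  then have "U \<noteq> {}" and finU: "finite U" by (auto simp: card_gt_0_iff)
  then obtain u0 where u0: "u0 \<in> U" by blast
  define p0 where "p0 = T (w @ u0 @ g u0) q0"
  have p0: "p0 \<in> E u0" using q0 R0 by (auto simp: p0_def E_def B_def)
  have Eball: "E u \<subseteq> K \<inter> ball p0 R" if "u \<in> U" for u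
  proof
    fix q assume q: "q \<in> E u"
    have "dist p0 q \<le> dist (fst p0) (fst q) + dist (snd p0) (snd q)"
      unfolding dist_prod_def by (rule sqrt_sum_squares_le_sum) auto
    also have "\<dots> \<le> 4 * \<alpha> ^ n + \<alpha> ^ n"
      using box[OF that q] box[OF u0 p0] unfolding dist_real_def by linarith
    also have "\<dots> < R" using pos(1)[of n] by (simp add: R_def)
    finally show "q \<in> K \<inter> ball p0 R" using EK[OF that] q by auto
  qed
  have bK: "bounded (K \<inter> ball p0 R)" by (intro bounded_K) auto
  obtain Y where Y: "finite Y" "card Y = covering_number r (K \<inter> ball p0 R)"
    "K \<inter> ball p0 R \<subseteq> (\<Union>y\<in>Y. ball y r)"
    using covering_number_witness[OF bK r(1)] by blast
  let ?hit = "\<lambda>u y. T (w @ u) ` ({0..1} \<times> {0..1}) \<inter> ball y r \<noteq> {}"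
  let ?N0 = "covering_number r0 (fst ` K \<inter> ball x0 R0)"
  have lower: "?N0 \<le> card {y \<in> Y. ?hit u y}" if u: "u \<in> U" for u
  proof -
    define L where "L = n + (l + G)"
    have len: "length (w @ u @ g u) = L" using word[OF u] by (simp add: words_def L_def)
    have bE: "bounded (E u)" using EK[OF u] by (rule bounded_K)
    have fE: "fst ` E u = (\<lambda>x. \<beta> ^ L * x + off (w @ u @ g u)) ` (fst ` K \<inter> ball x0 R0)"
      using len by (auto simp: E_def B_def T_def image_iff) force+
    have scale: "r \<le> \<beta> ^ L * r0"
    proof -
      have "\<eta> * \<alpha> ^ Suc n \<le> \<eta> * (\<beta> ^ n * \<rho>)" using low eta by (intro mult_left_mono) auto
      also have "\<dots> = \<beta> ^ L * r0" unfolding eta(3)[symmetric] by (simp add: \<rho>_def L_def power_add)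
      finally show ?thesis by (simp add: r_def)
    qed
    have "?N0 = covering_number (\<beta> ^ L * r0) (fst ` E u)"
      unfolding fE using r0(1) pos(2)
      by (intro covering_number_affine_image[symmetric] bounded_fst_K) auto
    also have "\<dots> \<le> covering_number r (fst ` E u)"
      using bE r(1) scale by (intro covering_number_antimono_radius) (auto simp: bounded_fst)
    also have "\<dots> \<le> covering_number r (E u)" using bE r(1) by (rule covering_number_fst_le)
    also have "\<dots> \<le> card {y \<in> Y. ?hit u y}"
    proof (rule covering_number_le)
      show "E u \<subseteq> (\<Union>y\<in>{y \<in> Y. ?hit u y}. ball y r)"
      proof
        fix q assume q: "q \<in> E u"
        then obtain y where y: "y \<in> Y" "q \<in> ball y r" using Eball[OF u] Y(3) by blast
        obtain p where p: "p \<in> K" "q = T (w @ u) (T (g u) p)"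
          using q T_append[of "w @ u" "g u"] by (auto simp: E_def B_def)
        have "T (g u) p \<in> {0..1} \<times> {0..1}"
          using K_unit[OF T_in_K[OF g(1)[OF u] p(1)]] by (simp add: mem_Times_iff)
        then have "q \<in> T (w @ u) ` ({0..1} \<times> {0..1}) \<inter> ball y r"
          unfolding p(2) using y(2) p(2) by (intro IntI imageI) auto
        then have "?hit u y" by (metis empty_iff)
        then have "y \<in> {y \<in> Y. ?hit u y}" using y(1) by simp
        then show "q \<in> (\<Union>y\<in>{y \<in> Y. ?hit u y}. ball y r)" using y(2) by (rule UN_I)
      qed
    qed (use Y(1) in simp)
    finally show ?thesis .
  qed
  have upper: "card {u \<in> U. ?hit u y} \<le> 9" for y
  proof -
    have "(\<lambda>u. w @ u) ` {u \<in> U. ?hit u y} \<subseteq>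
        {v \<in> words I (n + l). T v ` ({0..1} \<times> {0..1}) \<inter> ball y r \<noteq> {}}"
      using w U(1) words_append by blast
    then have "card {u \<in> U. ?hit u y} \<le>
        card {v \<in> words I (n + l). T v ` ({0..1} \<times> {0..1}) \<inter> ball y r \<noteq> {}}"
      using finite_words[OF fin] by (intro card_inj_on_le[of "\<lambda>u. w @ u"]) (auto simp: inj_on_def)
    then show ?thesis using words_meeting_ball_le[OF r(4), of y] by linarith
  qed
  have "card U * ?N0 = (\<Sum>u\<in>U. ?N0)" by simp
  also have "\<dots> \<le> (\<Sum>u\<in>U. card {y \<in> Y. ?hit u y})" by (intro sum_mono lower)
  also have "\<dots> = (\<Sum>y\<in>Y. card {u \<in> U. ?hit u y})"
    unfolding card_eq_sum by (rule sum.swap_restrict[OF finU Y(1)])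
  also have "\<dots> \<le> (\<Sum>y\<in>Y. 9)" by (intro sum_mono upper)
  also have "\<dots> = 9 * card Y" by simp
  finally have count: "real (card U) * real ?N0 \<le> 9 * real (card Y)"
    using of_nat_mono[of "card U * ?N0" "9 * card Y"] by simp
  have Rr: "R / r = 6 / \<alpha> * (R0 / r0)"
    using alpha_pos r0 R0 by (simp add: R_def r_def \<eta>_def field_simps)
  have "real (card Y) \<le> C * (R / r) powr A"
    unfolding Y(2) using r EK[OF u0] p0 by (intro C(2)) auto
  then have "9 * real (card Y) \<le> 9 * C * (6 / \<alpha> * (R0 / r0)) powr A" by (simp add: Rr)
  moreover have "(m * \<beta> powr t) ^ l * real ?N0 \<le> real (card U) * real ?N0"
    using U(2) by (intro mult_right_mono) auto
  ultimately show ?thesis using count by linarith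
qed

text \<open>Take \<open>l\<close> with \<open>\<alpha> ^ l\<close> comparable to \<open>r / R\<close> in the previous lemma and divide by \<open>(m \<beta>\<^sup>t)\<^sup>l\<close>, which is
  \<open>(R / r) powr \<kappa> t\<close> up to a constant.\<close>
lemma assouad_exponent_fst_K:
  assumes A: "assouad_exponent K A" and t: "0 \<le> t" "\<not> frostman_exponent \<nu> t"
  shows "assouad_exponent (fst ` K) (A - \<kappa> t)"
proof -
  obtain C where C: "0 < C" "\<And>r R p. 0 < r \<Longrightarrow> r \<le> R \<Longrightarrow> R \<le> 1 \<Longrightarrow> p \<in> K \<Longrightarrow>
       real (covering_number r (K \<inter> ball p R)) \<le> C * (R / r) powr A"
    using A unfolding assouad_exponent_def by blast
  \<comment> \<open>\<open>\<kappa> t\<close> may be negative, hence the minimum.\<close>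
  define c where "c = min 1 ((1 / \<alpha>) powr \<kappa> t)"
  have c: "0 < c" using alpha_pos by (simp add: c_def)
  define Q where "Q = 9 * C * (6 / \<alpha>) powr A / c"
  have Q: "0 < Q" using C c alpha_pos by (simp add: Q_def)
  have bound: "real (covering_number r (fst ` K \<inter> ball x R)) \<le> Q * (R / r) powr (A - \<kappa> t)"
    if rR: "0 < r" "r \<le> R" "R \<le> 1" and x: "x \<in> fst ` K" for r R x
  proof -
    let ?N = "real (covering_number r (fst ` K \<inter> ball x R))"
    define y where "y = R / r"
    have y: "1 \<le> y" using rR by (simp add: y_def)
    have "0 < r / R" "r / R \<le> 1" using rR by auto
    then obtain j where j: "\<alpha> ^ Suc j < r / R" "r / R \<le> \<alpha> ^ j"
      using geometric_level[OF alpha_pos parameter_bounds(2)] by blast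
    define l where "l = Suc j"
    have l: "0 < l" "\<alpha> * (r / R) \<le> \<alpha> ^ l" "\<alpha> ^ l \<le> r / R"
      using j mult_left_mono[OF j(2), of \<alpha>] alpha_pos unfolding l_def power_Suc by linarith+
    have lo: "y \<le> (1 / \<alpha>) ^ l" and hi: "(1 / \<alpha>) ^ l \<le> 1 / \<alpha> * y"
      using l(2,3) rR alpha_pos by (simp_all add: y_def power_divide field_simps)
    have "c * y powr \<kappa> t \<le> ((1 / \<alpha>) ^ l) powr \<kappa> t"
    proof (cases "0 \<le> \<kappa> t")
      case True
      have "c * y powr \<kappa> t \<le> 1 * y powr \<kappa> t" by (intro mult_right_mono) (auto simp: c_def)
      also have "1 * y powr \<kappa> t \<le> ((1 / \<alpha>) ^ l) powr \<kappa> t"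
        using powr_mono2[OF True _ lo] y by simp
      finally show ?thesis .
    next
      case False
      have "c * y powr \<kappa> t \<le> (1 / \<alpha>) powr \<kappa> t * y powr \<kappa> t"
        by (intro mult_right_mono) (auto simp: c_def)
      also have "\<dots> = (1 / \<alpha> * y) powr \<kappa> t" using y alpha_pos by (subst powr_mult) auto
      also have "\<dots> \<le> ((1 / \<alpha>) ^ l) powr \<kappa> t"
        using False hi alpha_pos by (intro powr_mono2') auto
      finally show ?thesis .
    qed
    also have "\<dots> = (m * \<beta> powr t) ^ l" using alpha_pos by (simp add: powr_power_swap kappa)
    finally have "c * y powr \<kappa> t * ?N \<le> (m * \<beta> powr t) ^ l * ?N" by (intro mult_right_mono) auto
    also have "\<dots> \<le> 9 * C * (6 / \<alpha> * y) powr A"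
      unfolding y_def by (rule spot_bound[OF x rR t C l(1,2)])
    also have "\<dots> = (Q * c) * y powr A"
      using c y alpha_pos by (subst powr_mult) (auto simp: Q_def)
    finally have "(c * y powr \<kappa> t) * ?N \<le> (c * y powr \<kappa> t) * (Q * y powr (A - \<kappa> t))"
      using y by (simp add: mult_ac flip: powr_add)
    moreover have "0 < c * y powr \<kappa> t" using c y by simp
    ultimately show ?thesis unfolding y_def by (simp only: mult_le_cancel_left_pos)
  qed
  \<comment> \<open>The exponent is nonnegative because covering numbers are at least 1 at all scales.\<close>
  have "1 \<le> 2 powr (A - \<kappa> t)"
  proof (rule one_le_ratio)
    fix n
    obtain x where x: "x \<in> fst ` K" using K_ne by blast
    have r: "0 < (1 / 2 :: real) ^ n" "(1 / 2 :: real) ^ n \<le> 1" by (simp_all add: power_le_one)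
    have "1 \<le> covering_number ((1 / 2) ^ n) (fst ` K \<inter> ball x 1)"
      using x by (intro covering_number_ge_1 bounded_fst_K) auto
    then have "1 \<le> real (covering_number ((1 / 2) ^ n) (fst ` K \<inter> ball x 1))" by linarith
    also have "\<dots> \<le> Q * (1 / (1 / 2) ^ n) powr (A - \<kappa> t)" using bound[OF r order_refl x] .
    also have "\<dots> = Q * (2 powr (A - \<kappa> t)) ^ n" by (simp add: power_divide powr_power_swap)
    finally show "1 \<le> Q * (2 powr (A - \<kappa> t)) ^ n" .
  qed simp
  then have "0 \<le> A - \<kappa> t" using powr_le_cancel_iff[of 2 0 "A - \<kappa> t"] by simp
  then show ?thesis unfolding assouad_exponent_def using Q bound by blast
qed

lemma frostman_exponents_bounded: "bdd_above {t. frostman_exponent \<nu> t}"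
proof (rule bdd_aboveI)
  fix t assume "t \<in> {t. frostman_exponent \<nu> t}"
  then show "t \<le> 1" using frostman_le_assouad assouad_exponent_1 by blast
qed

lemma frostman_exponent_0: "frostman_exponent \<nu> 0"
  unfolding frostman_exponent_def by (auto intro!: exI[of _ 1])

text \<open>Since \<open>\<kappa> t = c0 - t * c1\<close> with \<open>c1 > 0\<close>, the two inequalities between exponents say that
  \<open>(assouad_dim X + c0 - assouad_dim K) / c1\<close> is an upper bound of the Frostman exponents and a lower
  bound of the other nonnegative numbers.\<close>
lemma assouad_dim_K: "assouad_dim K = assouad_dim (fst ` K) + \<kappa> (frostman_dim \<nu>)"
proof (rule antisym)
  define c0 where "c0 = ln m / ln (1 / \<alpha>)"
  define c1 where "c1 = ln (1 / \<beta>) / ln (1 / \<alpha>)"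
  have c1: "0 < c1" using parameter_bounds alpha_pos beta_1 by (simp add: c1_def)
  have kap: "\<kappa> t = c0 - t * c1" for t by (simp add: kappa_affine c0_def c1_def)
  have bdd: "bdd_below {e. assouad_exponent F e}" for F :: "'c::euclidean_space set"
    by (rule bdd_belowI[of _ 0]) (simp add: assouad_exponent_def)
  have X: "assouad_exponent (fst ` K) 1" by (rule assouad_exponent_1)
  have upper: "t \<le> (assouad_dim (fst ` K) + c0 - assouad_dim K) / c1" if "frostman_exponent \<nu> t" for t
  proof -
    have "assouad_dim K - \<kappa> t \<le> e" if "assouad_exponent (fst ` K) e" for e
      using cInf_lower[OF _ bdd, of "e + \<kappa> t"] assouad_exponent_K[OF \<open>frostman_exponent \<nu> t\<close> that]
      unfolding assouad_dim_eq by fastforce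
    then have "assouad_dim K - \<kappa> t \<le> assouad_dim (fst ` K)"
      unfolding assouad_dim_eq using X by (intro cInf_greatest) auto
    then show ?thesis using c1 by (simp add: kap field_simps)
  qed
  have "frostman_dim \<nu> \<le> (assouad_dim (fst ` K) + c0 - assouad_dim K) / c1"
    unfolding frostman_dim_eq using frostman_exponent_0 upper by (intro cSup_least) auto
  then show "assouad_dim K \<le> assouad_dim (fst ` K) + \<kappa> (frostman_dim \<nu>)"
    using c1 by (simp add: kap field_simps)
  have "(assouad_dim (fst ` K) + c0 - assouad_dim K) / c1 \<le> frostman_dim \<nu>"
  proof (rule dense_ge)
    fix t assume t: "frostman_dim \<nu> < t"
    have "0 \<le> frostman_dim \<nu>"
      unfolding frostman_dim_eq
      by (rule cSup_upper) (use frostman_exponent_0 frostman_exponents_bounded in auto)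
    then have t0: "0 \<le> t" using t by simp
    have nt: "\<not> frostman_exponent \<nu> t"
      using t cSup_upper[OF _ frostman_exponents_bounded, of t] unfolding frostman_dim_eq by fastforce
    have "assouad_dim (fst ` K) + \<kappa> t \<le> A" if "assouad_exponent K A" for A
      using cInf_lower[OF _ bdd, of "A - \<kappa> t"] assouad_exponent_fst_K[OF that t0 nt]
      unfolding assouad_dim_eq by fastforce
    then have "assouad_dim (fst ` K) + \<kappa> t \<le> assouad_dim K"
      unfolding assouad_dim_eq[of K]
      using assouad_exponent_K[OF frostman_exponent_0 X] by (intro cInf_greatest) auto
    then show "(assouad_dim (fst ` K) + c0 - assouad_dim K) / c1 \<le> t"
      using c1 by (simp add: kap field_simps)
  qed
  then show "assouad_dim (fst ` K) + \<kappa> (frostman_dim \<nu>) \<le> assouad_dim K"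
    using c1 by (simp add: kap field_simps)
qed

end

theorem corollaryC:
  fixes \<alpha> \<beta> :: real and I :: "'i set" and a b :: "'i \<Rightarrow> real"
    and T :: "'i \<Rightarrow> real \<times> real \<Rightarrow> real \<times> real"
    and K :: "(real \<times> real) set" and \<nu> :: "real measure" and m :: nat and s :: real
  assumes "0 < \<alpha>" and "\<alpha> < \<beta>" and "\<beta> < 1"
    and "finite I" and "I \<noteq> {}" and "m = card I"
    and "\<And>i. i \<in> I \<Longrightarrow> 0 \<le> b i \<and> b i \<le> 1 - \<beta>"
    and "\<And>i. i \<in> I \<Longrightarrow> 0 \<le> a i \<and> a i \<le> 1 - \<alpha>"
    and "\<And>i x y. i \<in> I \<Longrightarrow> T i (x, y) = (\<beta> * x, \<alpha> * y) + (b i, a i)"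
    and "is_attractor I T K"
    and "\<And>i j. i \<in> I \<Longrightarrow> j \<in> I \<Longrightarrow> i \<noteq> j \<Longrightarrow>
           T i ` ({0<..<1} \<times> {0<..<1}) \<inter> T j ` ({0<..<1} \<times> {0<..<1}) = {}"
    and "is_uniform_self_similar_measure I (\<lambda>i x. \<beta> * x + b i) \<nu>"
    and "s = frostman_dim \<nu>"
  shows "assouad_dim K = assouad_dim (fst ` K) + ln (real m * \<beta> powr s) / ln (1 / \<alpha>)"
proof -
  have T: "T i p = (\<beta> * fst p + b i, \<alpha> * snd p + a i)" if "i \<in> I" for i p
    using assms(9)[OF that, of "fst p" "snd p"] by simp
  have overlap: "\<exists>x\<in>{0<..<1}. \<exists>y\<in>{0<..<1}. g * x + c = g * y + d"
    if "0 < g" "\<bar>c - d\<bar> < g" for g c d :: real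
  proof -
    \<comment> \<open>The midpoint of the two interval centres lies in both intervals; its preimages are \<open>1/2 - h\<close> and \<open>1/2 + h\<close>.\<close>
    define h where "h = (c - d) / (2 * g)"
    have h: "\<bar>h\<bar> < 1 / 2" using that by (simp add: h_def abs_mult)
    have "g * (1/2 - h) + c = g * (1/2 + h) + d"
      using that(1) by (simp add: h_def field_simps)
    moreover have "1/2 - h \<in> {0<..<1}" "1/2 + h \<in> {0<..<1}" using h by auto
    ultimately show ?thesis by blast
  qed
  interpret carpet_measure \<alpha> \<beta> I a b K \<nu>
  proof (unfold_locales)
    have "K = (\<Union>i\<in>I. T i ` K)" using assms(10) by (simp add: is_attractor_def)
    also have "\<dots> = (\<Union>i\<in>I. (\<lambda>p. (\<beta> * fst p + b i, \<alpha> * snd p + a i)) ` K)"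
      by (intro SUP_cong image_cong refl T)
    finally show "K = (\<Union>i\<in>I. (\<lambda>p. (\<beta> * fst p + b i, \<alpha> * snd p + a i)) ` K)" .
    fix i j assume ij: "i \<in> I" "j \<in> I" "i \<noteq> j"
    show "\<beta> \<le> \<bar>b i - b j\<bar> \<or> \<alpha> \<le> \<bar>a i - a j\<bar>"
    proof (rule ccontr)
      assume "\<not> ?thesis"
      then obtain x x' y y' where xy: "x \<in> {0<..<1}" "x' \<in> {0<..<1}" "y \<in> {0<..<1}" "y' \<in> {0<..<1}"
        "\<beta> * x + b i = \<beta> * x' + b j" "\<alpha> * y + a i = \<alpha> * y' + a j"
        using overlap[of \<beta> "b i" "b j"] overlap[of \<alpha> "a i" "a j"] assms(1,2) by auto
      then have "T i (x, y) = T j (x', y')" using T ij by simp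
      then show False using assms(11)[OF ij] xy(1-4) by blast
    qed
  qed (use assms in \<open>auto simp: is_attractor_def\<close>)
  show ?thesis using assouad_dim_K unfolding \<kappa>_def assms(6,13) .
qed

end
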